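(* Let $d\ge 1$, $T\ge 1$, let $K_t^j\subseteq\mathbb R$ ($j=1,\dots,d$, $t=0,\dots,T$) be closed sets, $\Omega=\prod_{t=0}^T\prod_{j=1}^d K_t^j$, and let $\mathcal E=\mathcal E_0\times\dots\times\mathcal E_T$, $U$, $V$, $\mathcal A$, $S^U$, $\mathcal D$, $\mathfrak P$ be as in the context. Assume: (i) $U:\mathcal E\to[-\infty,+\infty)$ is concave with $U(0)\in\mathbb R$, and $\mathcal A\subseteq C_{0:T}$ is a convex cone with $0\in\mathcal A$; (ii) for every $t=0,\dots,T$ there exist compact sets $\mathfrak K_t(n)\subseteq\prod_{j=1}^dK_t^j$ and functions $0\le f_t^n\in\mathcal E_t$, $n\ge 1$, such that $1+\sum_{t=0}^T\sum_{j=1}^d|x_t^j|\le\sum_{t=0}^T f_t^n(x_0,\dots,x_t)$ for all $x\in\Omega\setminus(\mathfrak K_0(n)\times\dots\times\mathfrak K_T(n))$, and $V(\Gamma f_0^n,\dots,\Gamma f_T^n)\to 0$ as $n\to\infty$ for every real $\Gamma>0$. Then: (a) If $\mathfrak P(\widehat c)<+\infty$ for some $\widehat c\in B_{0:T}$, then $\mathfrak P(c)\in\mathbb R$ for every $c\in B_{0:T}$, and $\mathfrak P:B_{0:T}\to\mathbb R$ is norm continuous, cash additive ($\mathfrak P(c+k)=\mathfrak P(c)+k$ for $k\in\mathbb R$), concave and nondecreasing on $B_{0:T}$. (b) For every lower semicontinuous $c:\Omega\to(-\infty,+\infty]$ such that $c(x)\ge -A\big(1+\sum_{t=0}^T\sum_{j=1}^d|x_t^j|\big)$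 for all $x\in\Omega$ and some $A\in[0,+\infty)$, we have $$\mathfrak P(c)=\inf_{Q\in\mathrm{Prob}^1(\Omega)\cap\mathcal A^\circ}\big(E_Q[c]+\mathcal D(Q)\big),$$ (with $\inf\emptyset=+\infty$), where $\mathcal D(Q)=\sup_{\varphi\in\mathcal E}\big(U(\varphi)-\sum_{t=0}^T\int_{\Omega_{0:t}}\varphi_t\,dQ_t\big)=\sup_{\varphi\in\mathcal E}\big(\sum_{t=0}^T\int_{\Omega_{0:t}}\varphi_t\,dQ_t-V(\varphi)\big)$. Furthermore, if $\mathfrak P(c)<+\infty$ the infimum is a minimum.
   Context: For $0\le t\le T$, $\Omega_{0:t}=\prod_{s=0}^t\prod_{j=1}^dK_s^j$; points $x=(x_0,\dots,x_T)\in\Omega$ with $x_t=(x_t^1,\dots,x_t^d)$. $C_{0:t}$ is the space of continuous $\phi:\Omega_{0:t}\to\mathbb R$ with $\|\phi\|_{0:t}:=\sup_{x}\frac{|\phi(x)|}{1+\sum_{s=0}^t\sum_{j=1}^d|x_s^j|}<\infty$; elements of $C_{0:t}$ are also regarded as functions on $\Omega$ depending only on $(x_0,\dots,x_t)$. $B_{0:T}$ is defined as $C_{0:T}$ but with Borel measurable instead of continuous functions, normed by $\|\cdot\|_{0:T}$. $(C_{0:T})^*$ is the topological dual of $C_{0:T}$. $\mathrm{Prob}^1(\Omega)$ is the set of Borel probability measures $Q$ on $\Omega$ with $\int|x_t^j|\,dQ<\infty$ for all $j,t$; such $Q$ is identified with the functional $c\mapsto E_Q[c]$ on $C_{0:T}$,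 and $Q_t$ is its marginal on $\Omega_{0:t}$. $\mathcal E_t$ are vector subspaces with $\mathbb R\subseteq\mathcal E_t\subseteq C_{0:t}$, $\mathcal E=\mathcal E_0\times\dots\times\mathcal E_T$, $U:\mathcal E\to[-\infty,+\infty)$, $V(\varphi):=-U(-\varphi)$. $S^U(\varphi):=\sup_{\beta\in\mathbb R^{T+1}}\big(U(\varphi+\beta)-\sum_{t=0}^T\beta_t\big)$ (componentwise addition) and $\mathrm{dom}(S^U)=\{\varphi\in\mathcal E:S^U(\varphi)>-\infty\}$. The polar of $\mathcal A$ is $\mathcal A^\circ=\{\lambda\in(C_{0:T})^*:\langle z,\lambda\rangle\le 0\ \forall z\in\mathcal A\}$; thus $Q\in\mathrm{Prob}^1(\Omega)\cap\mathcal A^\circ$ means $E_Q[z]\le0$ for all $z\in\mathcal A$. For measurable $c$ and $z\in-\mathcal A$, $\Phi_z(c)=\{\varphi\in\mathrm{dom}(S^U):\sum_{t=0}^T\varphi_t(x_0,\dots,x_t)+z(x)\le c(x)\ \forall x\in\Omega\}$ and $\mathfrak P(c)=\sup_{z\in-\mathcal A}\sup_{\varphi\in\Phi_z(c)}S^U(\varphi)\in[-\infty,+\infty]$, with $\sup\emptyset=-\infty$. *)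

theory Defs
  imports "HOL-Probability.Probability"
begin

text \<open>Points x = (x_0,...,x_T) with x_t in R^d are encoded as functions
  x :: nat \<times> nat \<Rightarrow> real, x (t,j) = x_t^j, for t \<le> T and j \<in> {1..d};
  all other coordinates are 0.  The space carries the (product) topology of the
  function type; on Omega it coincides with the Euclidean one.\<close>

type_synonym pt = "nat \<times> nat \<Rightarrow> real"
type_synonym fn = "pt \<Rightarrow> real"

definition Omega :: "nat \<Rightarrow> nat \<Rightarrow> (nat \<Rightarrow> nat \<Rightarrow> real set) \<Rightarrow> pt set" where
  "Omega d T K = {x. (\<forall>t\<le>T. \<forall>j\<in>{1..d}. x (t,j) \<in> K t j) \<and>
                     (\<forall>t j. (T < t \<or> j \<notin> {1..d}) \<longrightarrow> x (t,j) = 0)}"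

definition absum :: "nat \<Rightarrow> nat \<Rightarrow> pt \<Rightarrow> real" where
  "absum d t x = (\<Sum>s\<le>t. \<Sum>j=1..d. \<bar>x (s,j)\<bar>)"

text \<open>Functions on Omega are represented by functions on the whole type that vanish
  off Omega (so that functions equal on Omega are equal).  The constant k on Omega:\<close>
definition cst :: "pt set \<Rightarrow> real \<Rightarrow> fn" where
  "cst Om k = (\<lambda>x. if x \<in> Om then k else 0)"

definition Cspace :: "nat \<Rightarrow> nat \<Rightarrow> (nat \<Rightarrow> nat \<Rightarrow> real set) \<Rightarrow> nat \<Rightarrow> fn set" where
  "Cspace d T K t = {\<phi>. continuous_on (Omega d T K) \<phi> \<and>
      (\<forall>x. x \<notin> Omega d T K \<longrightarrow> \<phi> x = 0) \<and>
      (\<forall>x\<in>Omega d T K. \<forall>y\<in>Omega d T K.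
          (\<forall>s\<le>t. \<forall>j\<in>{1..d}. x (s,j) = y (s,j)) \<longrightarrow> \<phi> x = \<phi> y) \<and>
      (\<exists>M. \<forall>x\<in>Omega d T K. \<bar>\<phi> x\<bar> \<le> M * (1 + absum d t x))}"

definition normB :: "nat \<Rightarrow> nat \<Rightarrow> (nat \<Rightarrow> nat \<Rightarrow> real set) \<Rightarrow> fn \<Rightarrow> ereal" where
  "normB d T K c = (SUP x\<in>Omega d T K. ereal (\<bar>c x\<bar> / (1 + absum d T x)))"

text \<open>B_{0:T}: Borel measurable functions on Omega with finite norm (values off
  Omega are irrelevant).\<close>
definition Bspace :: "nat \<Rightarrow> nat \<Rightarrow> (nat \<Rightarrow> nat \<Rightarrow> real set) \<Rightarrow> fn set" where
  "Bspace d T K = {c. c \<in> borel_measurable (restrict_space borel (Omega d T K)) \<and>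
                      normB d T K c < \<infinity>}"

definition Ecal :: "nat \<Rightarrow> (nat \<Rightarrow> fn set) \<Rightarrow> (nat \<Rightarrow> fn) set" where
  "Ecal T E = {\<phi>. (\<forall>t\<le>T. \<phi> t \<in> E t) \<and> (\<forall>t>T. \<phi> t = (\<lambda>x. 0))}"

definition shift :: "nat \<Rightarrow> pt set \<Rightarrow> (nat \<Rightarrow> fn) \<Rightarrow> (nat \<Rightarrow> real) \<Rightarrow> (nat \<Rightarrow> fn)" where
  "shift T Om \<phi> \<beta> = (\<lambda>t. if t \<le> T then (\<lambda>x. \<phi> t x + cst Om (\<beta> t) x) else (\<lambda>x. 0))"

definition Vfun :: "((nat \<Rightarrow> fn) \<Rightarrow> ereal) \<Rightarrow> (nat \<Rightarrow> fn) \<Rightarrow> ereal" where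
  "Vfun U \<phi> = - U (\<lambda>t x. - \<phi> t x)"

definition SU :: "nat \<Rightarrow> pt set \<Rightarrow> ((nat \<Rightarrow> fn) \<Rightarrow> ereal) \<Rightarrow> (nat \<Rightarrow> fn) \<Rightarrow> ereal" where
  "SU T Om U \<phi> = (SUP \<beta>\<in>(UNIV :: (nat \<Rightarrow> real) set).
                     U (shift T Om \<phi> \<beta>) - ereal (\<Sum>t\<le>T. \<beta> t))"

definition domSU :: "nat \<Rightarrow> pt set \<Rightarrow> (nat \<Rightarrow> fn set) \<Rightarrow> ((nat \<Rightarrow> fn) \<Rightarrow> ereal)
                      \<Rightarrow> (nat \<Rightarrow> fn) set" where
  "domSU T Om E U = {\<phi> \<in> Ecal T E. SU T Om U \<phi> > -\<infinity>}"

definition Phi :: "nat \<Rightarrow> pt set \<Rightarrow> (nat \<Rightarrow> fn set) \<Rightarrow> ((nat \<Rightarrow> fn) \<Rightarrow> ereal)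
                    \<Rightarrow> fn \<Rightarrow> (pt \<Rightarrow> ereal) \<Rightarrow> (nat \<Rightarrow> fn) set" where
  "Phi T Om E U z c = {\<phi> \<in> domSU T Om E U.
       \<forall>x\<in>Om. ereal ((\<Sum>t\<le>T. \<phi> t x) + z x) \<le> c x}"

definition Pfrak :: "nat \<Rightarrow> pt set \<Rightarrow> (nat \<Rightarrow> fn set) \<Rightarrow> ((nat \<Rightarrow> fn) \<Rightarrow> ereal)
                     \<Rightarrow> fn set \<Rightarrow> (pt \<Rightarrow> ereal) \<Rightarrow> ereal" where
  "Pfrak T Om E U A c =
     (SUP z\<in>uminus ` A. SUP \<phi>\<in>Phi T Om E U z c. SU T Om U \<phi>)"

definition Prob1 :: "nat \<Rightarrow> nat \<Rightarrow> (nat \<Rightarrow> nat \<Rightarrow> real set) \<Rightarrow> pt measure set" where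
  "Prob1 d T K = {Q. prob_space Q \<and> sets Q = sets borel \<and>
       emeasure Q (Omega d T K) = 1 \<and>
       (\<forall>t\<le>T. \<forall>j\<in>{1..d}. integrable Q (\<lambda>x. x (t,j)))}"

definition polarP :: "fn set \<Rightarrow> pt measure set" where
  "polarP A = {Q. \<forall>z\<in>A. integral\<^sup>L Q z \<le> 0}"

definition ExpQ :: "pt measure \<Rightarrow> (pt \<Rightarrow> ereal) \<Rightarrow> ereal" where
  "ExpQ Q c = enn2ereal (\<integral>\<^sup>+ x. e2ennreal (c x) \<partial>Q)
            - enn2ereal (\<integral>\<^sup>+ x. e2ennreal (- c x) \<partial>Q)"

text \<open>\<D>(Q) = sup_{\<phi>\<in>\<E>} (U(\<phi>) - sum_t \<integral>\<phi>_t dQ_t); since \<phi>_t depends only on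
  (x_0..x_t), \<integral>\<phi>_t dQ_t = \<integral>\<phi>_t dQ.\<close>
definition Dcal :: "nat \<Rightarrow> (nat \<Rightarrow> fn set) \<Rightarrow> ((nat \<Rightarrow> fn) \<Rightarrow> ereal) \<Rightarrow> pt measure \<Rightarrow> ereal" where
  "Dcal T E U Q = (SUP \<phi>\<in>Ecal T E. U \<phi> - ereal (\<Sum>t\<le>T. integral\<^sup>L Q (\<phi> t)))"

definition lsc_on :: "pt set \<Rightarrow> (pt \<Rightarrow> ereal) \<Rightarrow> bool" where
  "lsc_on S c = (\<forall>x\<in>S. \<forall>y. y < c x \<longrightarrow> eventually (\<lambda>x'. y < c x') (at x within S))"

end

theory Submission
  imports Defs "HOL-Library.Function_Algebras"
begin

text \<open>
  Absorbing the shift \<open>\<beta>\<close> of \<open>S\<^sup>U\<close> into one real number, \<open>\<P>(c)\<close> is the supremum of \<open>U(\<psi>) - b\<close> over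
  \<open>\<psi> \<in> \<E>\<close>, \<open>a \<in> \<A>\<close>, \<open>b \<in> \<real>\<close> with \<open>\<Sum>\<psi>\<^sub>t - b - a \<le> c\<close>; concavity, monotonicity and cash additivity are
  then immediate, and assumption (ii) keeps \<open>\<P>\<close> above \<open>-\<infinity>\<close> on functions of linear growth.  A finite
  concave monotone functional is continuous in the weighted norm.

  For the duality, fix a lower semicontinuous \<open>c\<close> with \<open>\<P>(c) < \<infinity>\<close>.  The concave function
  \<open>g \<mapsto> \<P>(c + g)\<close> is finite for continuous \<open>g\<close> of linear growth, so the Hahn-Banach theorem gives a
  linear \<open>L\<close> with \<open>\<P>(c + g) \<le> \<P>(c) + L g\<close>.  Such an \<open>L\<close> is positive, normalised, nonpositive on \<open>\<A>\<close>,
  and satisfies \<open>L h + U(\<phi>) - L(\<Sum>\<phi>\<^sub>t) \<le> \<P>(c)\<close> whenever \<open>h \<le> c\<close>.  Taking \<open>\<phi> = -\<Gamma> f\<^sup>n\<close> makes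
  \<open>L(\<Sum>f\<^sup>n\<^sub>t)\<close> arbitrarily small, a tightness property which together with Dini's theorem turns \<open>L\<close>
  into a Daniell integral, hence a measure \<open>Q\<close>.  Approximating \<open>c\<close> from below by continuous \<open>h\<close>
  yields \<open>E\<^sub>Q[c] + \<D>(Q) \<le> \<P>(c)\<close>, so \<open>Q\<close> attains the infimum.
\<close>

section \<open>Functions as vectors\<close>

instantiation "fun" :: (type, real_vector) real_vector
begin

definition "r *\<^sub>R f = (\<lambda>x. r *\<^sub>R f x)"

instance
  by standard (simp_all add: scaleR_fun_def fun_eq_iff scaleR_add_right scaleR_add_left)

end

lemma scaleR_fun_apply [simp]: "(r *\<^sub>R f) x = r *\<^sub>R f x"
  by (simp add: scaleR_fun_def)

lemma sum_fun_apply [simp]: "(\<Sum>i\<in>I. f i) x = (\<Sum>i\<in>I. f i x)"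
  by (induction I rule: infinite_finite_induct) simp_all

section \<open>Hahn-Banach with a convex majorant\<close>

text \<open>A partial linear functional is represented by its graph, so that the graph of an extension is
  the span of one more pair.\<close>

definition linear_minorant :: "'a::real_vector set \<Rightarrow> ('a \<Rightarrow> real) \<Rightarrow> ('a \<times> real) set \<Rightarrow> bool" where
  "linear_minorant X N M \<longleftrightarrow> subspace M \<and> (\<forall>(x, r)\<in>M. x \<in> X \<and> r \<le> N x)"

lemma linear_minorant_slopes_le:
  assumes X: "subspace X" and N: "convex_on X N" and M: "linear_minorant X N M" and v: "v \<in> X"
    and p: "(p, a) \<in> M" "0 < s" and q: "(q, b) \<in> M" "0 < t"
  shows "(a - N (p - s *\<^sub>R v)) / s \<le> (N (q + t *\<^sub>R v) - b) / t"
proof -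
  define l where "l = s / (s + t)"
  have l: "0 \<le> l" "l \<le> 1" "l * t = (1 - l) * s" "(s + t) * l = s" "(s + t) * (1 - l) = t"
    using p q by (auto simp: l_def field_simps)
  have shifted_in_X: "p - s *\<^sub>R v \<in> X" "q + t *\<^sub>R v \<in> X"
    using M p q X v
    by (auto simp: linear_minorant_def intro!: subspace_diff subspace_add subspace_scale)
  have "(1 - l) *\<^sub>R (p, a) + l *\<^sub>R (q, b) \<in> M"
    using M p q by (intro subspace_add subspace_scale) (auto simp: linear_minorant_def)
  then have "(1 - l) * a + l * b \<le> N ((1 - l) *\<^sub>R p + l *\<^sub>R q)"
    using M by (auto simp: linear_minorant_def)
  also have "(1 - l) *\<^sub>R p + l *\<^sub>R q = (1 - l) *\<^sub>R (p - s *\<^sub>R v) + l *\<^sub>R (q + t *\<^sub>R v)"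
    by (simp add: scaleR_diff_right scaleR_add_right l(3))
  also have "N \<dots> \<le> (1 - l) * N (p - s *\<^sub>R v) + l * N (q + t *\<^sub>R v)"
    by (rule convex_onD[OF N l(1,2) shifted_in_X])
  finally have "(s + t) * ((1 - l) * (a - N (p - s *\<^sub>R v))) \<le> (s + t) * (l * (N (q + t *\<^sub>R v) - b))"
    using p(2) q(2) by (intro mult_left_mono) (auto simp: algebra_simps)
  then have "t * (a - N (p - s *\<^sub>R v)) \<le> s * (N (q + t *\<^sub>R v) - b)"
    by (simp only: mult.assoc[symmetric] l(4,5))
  then show ?thesis
    using p(2) q(2) by (simp add: field_simps)
qed

lemma linear_minorant_insert:
  assumes X: "subspace X" and N: "convex_on X N" and M: "linear_minorant X N M" and v: "v \<in> X"
  obtains \<alpha> where "linear_minorant X N (span (insert (v, \<alpha>) M))"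
proof -
  define slopes where "slopes = {(a - N (p - s *\<^sub>R v)) / s | p a s. (p, a) \<in> M \<and> 0 < s}"
  note slopes_le = linear_minorant_slopes_le[OF X N M v]
  have zero: "(0, 0) \<in> M"
    using M by (auto simp: linear_minorant_def zero_prod_def[symmetric] intro: subspace_0)
  have nonempty: "slopes \<noteq> {}"
    unfolding slopes_def using zero zero_less_one by blast
  have bdd: "bdd_above slopes"
    unfolding slopes_def using slopes_le[OF _ _ zero zero_less_one] by (intro bdd_aboveI) blast
  have lower: "(a - N (p - s *\<^sub>R v)) / s \<le> Sup slopes" if "(p, a) \<in> M" "0 < s" for p a s
    using that by (intro cSup_upper[OF _ bdd]) (auto simp: slopes_def)
  have upper: "Sup slopes \<le> (N (q + t *\<^sub>R v) - b) / t" if "(q, b) \<in> M" "0 < t" for q b t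
    using that slopes_le by (intro cSup_least[OF nonempty]) (auto simp: slopes_def)
  have "x \<in> X \<and> r \<le> N x" if xr: "(x, r) \<in> span (insert (v, Sup slopes) M)" for x r
  proof -
    obtain k where "(x, r) - k *\<^sub>R (v, Sup slopes) \<in> span M"
      using xr by (auto simp: span_insert)
    then have shifted: "(x - k *\<^sub>R v, r - k * Sup slopes) \<in> M"
      using M by (simp add: linear_minorant_def span_eq_iff[THEN iffD2])
    then have "(x - k *\<^sub>R v) + k *\<^sub>R v \<in> X"
      using M X v by (intro subspace_add subspace_scale) (auto simp: linear_minorant_def)
    moreover consider (zero) "k = 0" | (pos) "k > 0" | (neg) "k < 0" by linarith
    then have "r \<le> N x"
    proof cases
      case zero
      then show ?thesis using shifted M by (auto simp: linear_minorant_def)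
    next
      case pos
      then show ?thesis using upper[OF shifted pos] by (simp add: field_simps)
    next
      case neg
      then show ?thesis using lower[OF shifted, of "- k"] by (simp add: field_simps)
    qed
    ultimately show ?thesis by simp
  qed
  then show thesis
    by (intro that[of "Sup slopes"]) (auto simp: linear_minorant_def)
qed

lemma linear_minorant_Union_chain:
  assumes "\<C> \<noteq> {}" and chain: "subset.chain {M. linear_minorant X N M} \<C>"
  shows "linear_minorant X N (\<Union>\<C>)"
proof -
  have minorant: "linear_minorant X N M" if "M \<in> \<C>" for M
    using chain that by (auto simp: subset.chain_def)
  have "x + y \<in> \<Union>\<C>" if x: "x \<in> \<Union>\<C>" and y: "y \<in> \<Union>\<C>" for x y
  proof -
    obtain M M' where M: "M \<in> \<C>" "x \<in> M" and M': "M' \<in> \<C>" "y \<in> M'"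
      using x y by blast
    then have "M \<subseteq> M' \<or> M' \<subseteq> M"
      using chain by (auto simp: subset.chain_def)
    with M M' obtain M'' where "M'' \<in> \<C>" "x \<in> M''" "y \<in> M''" by blast
    then show ?thesis
      using minorant[of M''] subspace_add[of M'' x y] by (auto simp: linear_minorant_def)
  qed
  moreover have "c *\<^sub>R x \<in> \<Union>\<C>" if "x \<in> \<Union>\<C>" for c x
    using that minorant subspace_scale by (fastforce simp: linear_minorant_def)
  moreover have "0 \<in> \<Union>\<C>"
    using assms(1) minorant subspace_0 by (fastforce simp: linear_minorant_def)
  ultimately have "subspace (\<Union>\<C>)" by (simp add: subspace_def)
  then show ?thesis
    using minorant by (fastforce simp: linear_minorant_def)
qed

lemma total_linear_minorant_exists:
  assumes X: "subspace X" and N: "convex_on X N" and "0 \<le> N 0"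
  obtains M where "linear_minorant X N M" "\<And>x. x \<in> X \<Longrightarrow> \<exists>r. (x, r) \<in> M"
proof -
  have "\<exists>M\<in>{M. linear_minorant X N M}. \<forall>Y\<in>{M. linear_minorant X N M}. M \<subseteq> Y \<longrightarrow> Y = M"
  proof (rule subset_Zorn_nonempty)
    have "subspace {(0, 0) :: 'a \<times> real}" by (simp flip: zero_prod_def)
    then have "linear_minorant X N {(0, 0)}"
      using assms(3) subspace_0[OF X] by (simp add: linear_minorant_def)
    then show "{M. linear_minorant X N M} \<noteq> {}" by blast
  qed (auto intro: linear_minorant_Union_chain)
  then obtain M where M: "linear_minorant X N M"
    and maximal: "\<And>Y. linear_minorant X N Y \<Longrightarrow> M \<subseteq> Y \<Longrightarrow> Y = M"
    by blast
  have "\<exists>r. (x, r) \<in> M" if x: "x \<in> X" for x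
  proof -
    obtain \<alpha> where \<alpha>: "linear_minorant X N (span (insert (x, \<alpha>) M))"
      using linear_minorant_insert[OF X N M x] .
    have "insert (x, \<alpha>) M \<subseteq> span (insert (x, \<alpha>) M)" by (rule span_superset)
    with maximal[OF \<alpha>] show ?thesis by auto
  qed
  with M show thesis by (rule that)
qed

theorem Hahn_Banach_convex_majorant:
  fixes X :: "'a::real_vector set"
  assumes X: "subspace X" and N: "convex_on X N" and N0: "0 \<le> N 0"
  obtains L :: "'a \<Rightarrow> real" where "linear L" "\<And>x. x \<in> X \<Longrightarrow> L x \<le> N x"
proof -
  obtain M where M: "linear_minorant X N M" and total: "\<And>x. x \<in> X \<Longrightarrow> \<exists>r. (x, r) \<in> M"
    using total_linear_minorant_exists[OF X N N0] by blast
  obtain B where B: "B \<subseteq> X" "independent B" "X \<subseteq> span B"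
    by (rule maximal_independent_subset)
  obtain r where r: "\<And>b. b \<in> B \<Longrightarrow> (b, r b) \<in> M"
    using total B(1) by (metis subsetD)
  obtain L where L: "linear L" "\<And>b. b \<in> B \<Longrightarrow> L b = r b"
    using linear_independent_extend[OF B(2), of r] by blast
  have "linear (\<lambda>x. (x, L x))"
    using L(1) by (intro linearI) (auto simp: linear_add linear_scale)
  then have "subspace {x. (x, L x) \<in> M}"
    using M by (intro linear_subspace_linear_preimage) (auto simp: linear_minorant_def)
  then have "(x, L x) \<in> M" if "x \<in> X" for x
    using span_induct[of x B "\<lambda>x. (x, L x) \<in> M"] r L(2) B(3) that by auto
  with M show thesis
    by (intro that[of L] L(1)) (auto simp: linear_minorant_def)
qed

section \<open>Daniell integrals\<close>

definition strip :: "('a \<Rightarrow> real) \<Rightarrow> ('a \<Rightarrow> real) \<Rightarrow> ('a \<times> real) set" where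
  "strip f g = {(x, t). f x \<le> t \<and> t < g x}"

lemma strip_section: "Pair x -` strip f g = {f x..<g x}"
  by (auto simp: strip_def)

lemma strip_eq_imp_height_eq:
  assumes "f \<le> g" "f' \<le> g'" "strip f g = strip f' g'"
  shows "g - f = g' - f'"
proof
  fix x
  have "emeasure lborel {f x..<g x} = emeasure lborel {f' x..<g' x}"
    using arg_cong[OF assms(3), of "\<lambda>A. emeasure lborel (Pair x -` A)"]
    by (simp only: strip_section)
  then show "(g - f) x = (g' - f') x"
    using assms(1,2) by (simp add: le_fun_def)
qed

lemma strip_Union_height_sums:
  assumes ordered: "\<And>n. f n \<le> g n" "u \<le> v"
    and disj: "disjoint_family (\<lambda>n. strip (f n) (g n))"
    and Union_eq: "(\<Union>n. strip (f n) (g n)) = strip u v"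
  shows "(\<lambda>n. (g n - f n) x) sums (v - u) x"
proof -
  have "(\<Sum>n. emeasure lborel (Pair x -` strip (f n) (g n)))
      = emeasure lborel (\<Union>n. Pair x -` strip (f n) (g n))"
  proof (rule suminf_emeasure)
    show "range (\<lambda>n. Pair x -` strip (f n) (g n)) \<subseteq> sets lborel" by (auto simp: strip_section)
    show "disjoint_family (\<lambda>n. Pair x -` strip (f n) (g n))"
      using disj unfolding disjoint_family_on_def by blast
  qed
  also have "(\<Union>n. Pair x -` strip (f n) (g n)) = Pair x -` strip u v"
    unfolding Union_eq[symmetric] by (rule vimage_UN[symmetric])
  finally have "(\<Sum>n. ennreal (g n x - f n x)) = ennreal (v x - u x)"
    using ordered by (simp add: strip_section le_fun_def)
  moreover have "(\<lambda>n. ennreal (g n x - f n x)) sums (\<Sum>n. ennreal (g n x - f n x))"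
    by (simp add: summable_sums)
  ultimately show ?thesis
    using ordered by (simp add: le_fun_def sums_ennreal)
qed

lemma sum_clamp:
  fixes z :: real
  assumes "0 \<le> z"
  shows "(\<Sum>k<n. max 0 (min 1 (z - real k))) = min z (real n)"
  using assms by (induction n) (simp_all add: min_def max_def)

text \<open>
  The measure is obtained by Kindler's construction: \<open>L\<close> induces a countably additive volume on the
  semiring of strips between two functions of \<open>H\<close>, because a disjoint decomposition of a strip
  is, section by section, a convergent series of heights.
\<close>

locale daniell_functional =
  fixes H :: "('a::topological_space \<Rightarrow> real) set" and L :: "('a \<Rightarrow> real) \<Rightarrow> real" and S :: "'a set"
  assumes subspace_H: "subspace H"
    and sup_H: "\<And>f g. f \<in> H \<Longrightarrow> g \<in> H \<Longrightarrow> sup f g \<in> H"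
    and indicator_H: "indicator S \<in> H"
    and zero_outside: "\<And>f x. f \<in> H \<Longrightarrow> x \<notin> S \<Longrightarrow> f x = 0"
    and measurable_H: "\<And>f. f \<in> H \<Longrightarrow> f \<in> borel_measurable borel"
    and positivity_set: "\<And>G. open G \<Longrightarrow> \<exists>h\<in>H. 0 \<le> h \<and> {x. 0 < h x} = G \<inter> S"
    and linear_L: "linear L"
    and L_nonneg: "\<And>f. f \<in> H \<Longrightarrow> 0 \<le> f \<Longrightarrow> 0 \<le> L f"
    and L_indicator: "L (indicator S) = 1"
    and L_tendsto_0: "\<And>g. (\<And>n. g n \<in> H) \<Longrightarrow> decseq g \<Longrightarrow> (\<And>x. (\<lambda>n. g n x) \<longlonglongrightarrow> 0) \<Longrightarrow>
      (\<lambda>n. L (g n)) \<longlonglongrightarrow> 0"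
begin

lemma inf_H:
  assumes "f \<in> H" "g \<in> H"
  shows "inf f g \<in> H"
proof -
  have "inf f g = f + g - sup f g"
    by (auto simp: fun_eq_iff inf_min sup_max)
  then show ?thesis
    using assms by (simp add: subspace_H sup_H subspace_add subspace_diff)
qed

lemmas H_closed = subspace_0[OF subspace_H] subspace_add[OF subspace_H] subspace_diff[OF subspace_H]
  subspace_scale[OF subspace_H] subspace_sum[OF subspace_H] indicator_H sup_H inf_H

lemma L_tendsto:
  assumes "\<And>n. g n \<in> H" "f \<in> H" "incseq g" "\<And>x. (\<lambda>n. g n x) \<longlonglongrightarrow> f x"
  shows "(\<lambda>n. L (g n)) \<longlonglongrightarrow> L f"
proof -
  have "(\<lambda>n. L (f - g n)) \<longlonglongrightarrow> 0"
  proof (rule L_tendsto_0)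
    show "f - g n \<in> H" for n using assms(1,2) by (intro H_closed)
    show "decseq (\<lambda>n. f - g n)" using incseq_SucD[OF assms(3)] by (intro decseq_SucI diff_left_mono)
    show "(\<lambda>n. (f - g n) x) \<longlonglongrightarrow> 0" for x
      using tendsto_diff[OF tendsto_const assms(4), of "f x" x] by simp
  qed
  from tendsto_diff[OF tendsto_const this, of "L f"] show ?thesis
    by (simp add: linear_diff[OF linear_L])
qed

lemma L_sums:
  assumes h: "\<And>n. h n \<in> H" "\<And>n. 0 \<le> h n" and v: "v \<in> H" and sums: "\<And>x. (\<lambda>n. h n x) sums v x"
  shows "(\<lambda>n. L (h n)) sums L v"
proof -
  have "(\<lambda>n. L (\<Sum>k<n. h k)) \<longlonglongrightarrow> L v"
  proof (rule L_tendsto)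
    show "(\<Sum>k<n. h k) \<in> H" for n using h(1) by (intro H_closed)
    show "incseq (\<lambda>n. \<Sum>k<n. h k)" using h(2) by (intro incseq_SucI) simp
    show "(\<lambda>n. (\<Sum>k<n. h k) x) \<longlonglongrightarrow> v x" for x using sums by (simp add: sums_def)
  qed (rule v)
  then show ?thesis by (simp add: sums_def linear_sum[OF linear_L])
qed

definition strip_measure :: "('a \<times> real) measure" where
  "strip_measure = extend_measure UNIV {(f, g). f \<in> H \<and> g \<in> H \<and> f \<le> g}
    (\<lambda>(f, g). strip f g) (\<lambda>(f, g). ennreal (L (g - f)))"

lemma semiring_strips: "semiring_of_sets UNIV {strip f g | f g. f \<in> H \<and> g \<in> H \<and> f \<le> g}"
  (is "semiring_of_sets _ ?strips")
proof
  have stripsI: "strip f g \<in> ?strips" if "f \<in> H" "g \<in> H" "f \<le> g" for f g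
    using that by blast
  have "strip 0 0 = ({} :: ('a \<times> real) set)" by (auto simp: strip_def)
  then show "{} \<in> ?strips" using stripsI[of 0 0] H_closed(1) by simp
  fix s t assume "s \<in> ?strips" "t \<in> ?strips"
  then obtain f g f' g' where s: "s = strip f g" "f \<in> H" "g \<in> H" "f \<le> g"
    and t: "t = strip f' g'" "f' \<in> H" "g' \<in> H" "f' \<le> g'"
    by blast
  have "s \<inter> t = strip (sup f f') (sup (sup f f') (inf g g'))"
    by (auto simp: s t strip_def sup_max inf_min)
  then show "s \<inter> t \<in> ?strips"
    using stripsI[of "sup f f'" "sup (sup f f') (inf g g')"] s t H_closed by simp
  let ?below = "strip f (sup f (inf g f'))" and ?above = "strip (inf g (sup f g')) g"
  have "(x, r) \<in> s - t \<longleftrightarrow> (x, r) \<in> ?below \<union> ?above" "(x, r) \<notin> ?below \<inter> ?above" for x r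
    using le_funD[OF s(4), of x] le_funD[OF t(4), of x]
    by (auto simp: s(1) t(1) strip_def sup_max inf_min min_def max_def split: if_splits)
  then have "s - t = ?below \<union> ?above" "?below \<inter> ?above = {}"
    by (intro set_eqI; simp only: split_paired_all empty_iff)+
  moreover have "?below \<in> ?strips" "?above \<in> ?strips"
    by (intro stripsI H_closed s t sup.cobounded1 inf.cobounded1)+
  ultimately show "\<exists>C\<subseteq>?strips. finite C \<and> disjoint C \<and> s - t = \<Union>C"
    by (intro exI[of _ "{?below, ?above}"]) (auto simp: disjoint_def)
qed simp

lemma emeasure_strip:
  assumes "f \<in> H" "g \<in> H" "f \<le> g"
  shows "emeasure strip_measure (strip f g) = ennreal (L (g - f))"
proof (rule extend_measure_caratheodory_pair[OF strip_measure_def _ semiring_strips])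
  show "ennreal (L (g - f)) = 0" if "f \<in> H \<and> g \<in> H \<and> f \<le> g" "strip f g = {}" for f g
  proof -
    have "g - f = 0 - 0"
      using that by (intro strip_eq_imp_height_eq) (auto simp: strip_def)
    then show ?thesis by (simp add: linear_0[OF linear_L])
  qed
  show "ennreal (L (g - f)) = ennreal (L (g' - f'))"
    if "f \<in> H \<and> g \<in> H \<and> f \<le> g" "f' \<in> H \<and> g' \<in> H \<and> f' \<le> g'" "strip f g = strip f' g'" for f g f' g'
    using that strip_eq_imp_height_eq[of f g f' g'] by simp
  fix f g :: "nat \<Rightarrow> 'a \<Rightarrow> real" and u v :: "'a \<Rightarrow> real"
  assume fg: "\<And>n. f n \<in> H \<and> g n \<in> H \<and> f n \<le> g n" and uv: "u \<in> H \<and> v \<in> H \<and> u \<le> v"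
    and union: "disjoint_family (\<lambda>n. strip (f n) (g n))" "(\<Union>n. strip (f n) (g n)) = strip u v"
  have "(\<lambda>n. L (g n - f n)) sums L (v - u)"
    using fg uv strip_Union_height_sums[OF _ _ union] H_closed
    by (intro L_sums) auto
  moreover have "0 \<le> L (g n - f n)" for n
    using fg[of n] by (intro L_nonneg H_closed) auto
  ultimately show "(\<Sum>n. ennreal (L (g n - f n))) = ennreal (L (v - u))"
    by (intro suminf_ennreal_eq)
qed (use assms in auto)

lemma strip_in_sets:
  assumes "f \<in> H" "g \<in> H" "f \<le> g"
  shows "strip f g \<in> sets strip_measure"
  unfolding strip_measure_def using assms by (subst sets_extend_measure) auto

abbreviation base :: "('a \<times> real) set" where
  "base \<equiv> strip 0 (indicator S)"

lemma mem_base_iff: "(x, t) \<in> base \<longleftrightarrow> x \<in> S \<and> 0 \<le> t \<and> t < 1"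
  by (auto simp: strip_def indicator_def)

lemma base_in_sets: "base \<in> sets strip_measure"
  by (intro strip_in_sets H_closed) (simp add: le_fun_def)

lemma space_restrict_base: "space (restrict_space strip_measure base) = base"
  using sets.sets_into_space[OF base_in_sets] by (auto simp: space_restrict_space)

lemma vimage_fst_open_Int_base:
  assumes h: "0 \<le> h" "{x. 0 < h x} = G \<inter> S"
  shows "fst -` G \<inter> base = (\<Union>n::nat. strip 0 (inf (indicator S) (real n *\<^sub>R h)))"
proof (intro set_eqI iffI; clarify)
  fix x t assume "(x, t) \<in> base" "fst (x, t) \<in> G"
  then have x: "x \<in> S" "0 \<le> t" "t < 1" "0 < h x" using h(2) by (auto simp: mem_base_iff)
  then obtain n where "t / h x < real n" using reals_Archimedean2 by blast
  then show "(x, t) \<in> (\<Union>n. strip 0 (inf (indicator S) (real n *\<^sub>R h)))"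
    using x by (auto simp: strip_def inf_min field_simps)
next
  fix x t n assume "(x, t) \<in> strip 0 (inf (indicator S) (real n *\<^sub>R h))"
  then have t: "0 \<le> t" "t < indicator S x" "t < real n * h x" by (auto simp: strip_def inf_min)
  then have "0 < real n * h x" by linarith
  then have "x \<in> G" using h(2) by (auto simp: zero_less_mult_iff)
  then show "(x, t) \<in> fst -` G \<inter> base" using t by (auto simp: strip_def)
qed

lemma measurable_fst_base: "fst \<in> restrict_space strip_measure base \<rightarrow>\<^sub>M borel"
proof (rule borel_measurableI)
  fix G :: "'a set" assume "open G"
  then obtain h where h: "h \<in> H" "0 \<le> h" "{x. 0 < h x} = G \<inter> S"
    using positivity_set by blast
  have "strip 0 (inf (indicator S) (real n *\<^sub>R h)) \<in> sets strip_measure" for n :: nat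
    using h by (intro strip_in_sets H_closed) (simp_all add: le_fun_def inf_min)
  then have "fst -` G \<inter> base \<in> sets strip_measure"
    unfolding vimage_fst_open_Int_base[OF h(2,3)] by blast
  then show "fst -` G \<inter> space (restrict_space strip_measure base)
      \<in> sets (restrict_space strip_measure base)"
    using base_in_sets by (auto simp: sets_restrict_space space_restrict_base)
qed

definition representing_measure :: "'a measure" where
  "representing_measure = distr (restrict_space strip_measure base) borel fst"

lemma sets_representing_measure [simp, measurable_cong]: "sets representing_measure = sets borel"
  by (simp add: representing_measure_def)

lemma space_representing_measure [simp]: "space representing_measure = UNIV"
  by (simp add: representing_measure_def)

lemma vimage_fst_Int_base_in_sets: "B \<in> sets borel \<Longrightarrow> fst -` B \<inter> base \<in> sets strip_measure"
  using measurable_sets[OF measurable_fst_base, of B] base_in_sets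
  by (simp add: space_restrict_base sets_restrict_space_iff)

lemma emeasure_representing_measure:
  assumes "B \<in> sets borel"
  shows "emeasure representing_measure B = emeasure strip_measure (fst -` B \<inter> base)"
  unfolding representing_measure_def using assms base_in_sets
  by (simp add: emeasure_distr[OF measurable_fst_base] space_restrict_base emeasure_restrict_space)

lemma S_in_borel: "S \<in> sets borel"
proof -
  have "S = (indicator S :: 'a \<Rightarrow> real) -` {1} \<inter> space borel"
    by (auto simp: indicator_def split: if_splits)
  also have "\<dots> \<in> sets borel" by (rule measurable_sets[OF measurable_H[OF indicator_H]]) simp
  finally show ?thesis .
qed

lemma emeasure_base: "emeasure strip_measure base = 1"
  using emeasure_strip[of 0 "indicator S"] by (simp add: H_closed L_indicator le_fun_def)

lemma emeasure_representing_measure_S: "emeasure representing_measure S = 1"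
proof -
  have "fst -` S \<inter> base = base" by (auto simp: mem_base_iff)
  then show ?thesis using emeasure_representing_measure[OF S_in_borel] emeasure_base by simp
qed

lemma prob_space_representing_measure: "prob_space representing_measure"
  using emeasure_representing_measure[of UNIV] emeasure_base by (intro prob_spaceI) simp

text \<open>A layer-cake estimate bounds \<open>L f\<close> by the integral of \<open>f\<close> for \<open>0 \<le> f \<le> 1\<^sub>S\<close>; applied to \<open>1\<^sub>S - f\<close>
  as well, it gives equality.\<close>

definition layer :: "('a \<Rightarrow> real) \<Rightarrow> nat \<Rightarrow> nat \<Rightarrow> 'a \<Rightarrow> real" where
  "layer f n k = sup 0 (inf (indicator S) (real n *\<^sub>R f - real k *\<^sub>R indicator S))"

lemma layer_in_H: "f \<in> H \<Longrightarrow> layer f n k \<in> H"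
  unfolding layer_def by (intro H_closed)

lemma sum_layers:
  assumes "0 \<le> f" "f \<le> indicator S"
  shows "(\<Sum>k<n. layer f n k) = real n *\<^sub>R f"
proof
  fix x
  have f: "0 \<le> f x" "f x \<le> indicator S x" using assms by (auto simp: le_fun_def)
  show "(\<Sum>k<n. layer f n k) x = (real n *\<^sub>R f) x"
  proof (cases "x \<in> S")
    case True
    then have "(\<Sum>k<n. layer f n k) x = (\<Sum>k<n. max 0 (min 1 (real n * f x - real k)))"
      by (simp add: layer_def sup_max inf_min)
    also have "\<dots> = real n * f x"
      using f True by (simp add: sum_clamp mult_left_le min_absorb1)
    finally show ?thesis by simp
  next
    case False
    then show ?thesis using f by (simp add: layer_def sup_max)
  qed
qed

lemma L_layer_le:
  assumes "f \<in> H"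
  shows "L (layer f n k) \<le> measure representing_measure {x. real k < real n * f x}"
proof -
  interpret prob_space representing_measure by (rule prob_space_representing_measure)
  note [measurable] = measurable_H[OF assms]
  let ?B = "{x. real k < real n * f x}"
  have B: "?B \<in> sets borel" by measurable
  have "ennreal (L (layer f n k)) = emeasure strip_measure (strip 0 (layer f n k))"
    using emeasure_strip[of 0 "layer f n k"] layer_in_H[OF assms]
    by (simp add: H_closed) (simp add: layer_def)
  also have "\<dots> \<le> emeasure strip_measure (fst -` ?B \<inter> base)"
  proof (rule emeasure_mono[OF _ vimage_fst_Int_base_in_sets[OF B]], clarify)
    fix x t assume "(x, t) \<in> strip 0 (layer f n k)"
    then have t: "0 \<le> t" "t < indicator S x" "t < real n * f x - real k * indicator S x"
      by (auto simp: strip_def layer_def sup_max inf_min)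
    then show "(x, t) \<in> fst -` ?B \<inter> base"
      by (cases "x \<in> S") (auto simp: mem_base_iff)
  qed
  also have "\<dots> = ennreal (measure representing_measure ?B)"
    using emeasure_representing_measure[OF B] by (simp add: emeasure_eq_measure)
  finally show ?thesis by simp
qed

lemma sum_measure_layers_le:
  assumes f: "f \<in> H" "0 \<le> f" "integrable representing_measure f"
  shows "(\<Sum>k<n. measure representing_measure {x. real k < real n * f x})
    \<le> real n * integral\<^sup>L representing_measure f + 1"
proof -
  interpret prob_space representing_measure by (rule prob_space_representing_measure)
  note [measurable] = measurable_H[OF f(1)]
  have "(\<Sum>k<n. measure representing_measure {x. real k < real n * f x})
      = (\<integral>x. (\<Sum>k<n. indicator {x. real k < real n * f x} x) \<partial>representing_measure)"
    by (subst Bochner_Integration.integral_sum) (auto simp: emeasure_eq_measure)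
  also have "\<dots> \<le> (\<integral>x. real n * f x + 1 \<partial>representing_measure)"
  proof (intro integral_mono)
    fix x
    have "(\<Sum>k<n. indicator {x. real k < real n * f x} x)
        \<le> (\<Sum>k<n. max 0 (min 1 (real n * f x + 1 - real k)))"
      by (intro sum_mono) (auto simp: indicator_def)
    also have "\<dots> \<le> real n * f x + 1"
      using f(2) by (subst sum_clamp) (auto simp: le_fun_def)
    finally show "(\<Sum>k<n. indicator {x. real k < real n * f x} x) \<le> real n * f x + 1" .
  qed (use f in \<open>auto simp: emeasure_eq_measure\<close>)
  also have "\<dots> = real n * integral\<^sup>L representing_measure f + 1"
    using f(3) prob_space by simp
  finally show ?thesis .
qed

lemma integrable_between_0_indicator:
  assumes "f \<in> H" "0 \<le> f" "f \<le> indicator S"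
  shows "integrable representing_measure f"
proof -
  interpret prob_space representing_measure by (rule prob_space_representing_measure)
  have "0 \<le> f x \<and> f x \<le> 1" for x
    using assms(2,3) by (auto simp: le_fun_def indicator_def intro: order_trans)
  then show ?thesis
    using measurable_H[OF assms(1)] by (intro integrable_const_bound[of _ 1]) auto
qed

lemma L_le_integral:
  assumes f: "f \<in> H" "0 \<le> f" "f \<le> indicator S"
  shows "L f \<le> integral\<^sup>L representing_measure f"
proof (rule LIMSEQ_le_const)
  show "(\<lambda>n. integral\<^sup>L representing_measure f + 1 / real n) \<longlonglongrightarrow> integral\<^sup>L representing_measure f"
    using tendsto_add[OF tendsto_const lim_1_over_n, of "integral\<^sup>L representing_measure f"] by simp
  have "L f \<le> integral\<^sup>L representing_measure f + 1 / real n" if "1 \<le> n" for n :: nat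
  proof -
    have "real n * L f = (\<Sum>k<n. L (layer f n k))"
      using sum_layers[OF f(2,3), of n] linear_sum[OF linear_L, of "layer f n" "{..<n}"]
      by (simp add: linear_scale[OF linear_L])
    also have "\<dots> \<le> (\<Sum>k<n. measure representing_measure {x. real k < real n * f x})"
      by (intro sum_mono L_layer_le f)
    also have "\<dots> \<le> real n * integral\<^sup>L representing_measure f + 1"
      by (intro sum_measure_layers_le f integrable_between_0_indicator)
    finally show ?thesis using that by (simp add: field_simps)
  qed
  then show "\<exists>N. \<forall>n\<ge>N. L f \<le> integral\<^sup>L representing_measure f + 1 / real n" by blast
qed

lemma L_eq_integral_between_0_indicator:
  assumes f: "f \<in> H" "0 \<le> f" "f \<le> indicator S"
  shows "L f = integral\<^sup>L representing_measure f"
proof (rule antisym[OF L_le_integral[OF f]])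
  interpret prob_space representing_measure by (rule prob_space_representing_measure)
  have "L (indicator S - f) \<le> integral\<^sup>L representing_measure (indicator S - f)"
    using f by (intro L_le_integral H_closed) (simp_all add: le_fun_def)
  also have "\<dots> = 1 - integral\<^sup>L representing_measure f"
    unfolding fun_diff_def
    using integrable_between_0_indicator[OF f] S_in_borel emeasure_representing_measure_S
    by (subst Bochner_Integration.integral_diff) (auto simp: emeasure_eq_measure)
  finally show "integral\<^sup>L representing_measure f \<le> L f"
    by (simp add: linear_diff[OF linear_L] L_indicator)
qed

lemma has_bochner_integral_nonneg:
  assumes f: "f \<in> H" "0 \<le> f"
  shows "has_bochner_integral representing_measure f (L f)"
proof -
  define g where "g n = inf f (real (Suc n) *\<^sub>R indicator S)" for n
  have g_in_H: "g n \<in> H" for n unfolding g_def using f(1) by (intro H_closed)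
  have g: "integrable representing_measure (g n) \<and>
    integral\<^sup>L representing_measure (g n) = L (g n)" for n
  proof -
    let ?h = "(1 / real (Suc n)) *\<^sub>R g n"
    have h: "?h \<in> H" "0 \<le> ?h" "?h \<le> indicator S"
      using f g_in_H[of n]
      by (auto simp: g_def le_fun_def inf_min indicator_def field_simps intro!: H_closed)
    have "g n = (\<lambda>x. real (Suc n) * ?h x)" by (auto simp del: of_nat_Suc)
    moreover have "L (g n) = real (Suc n) * L ?h"
      by (simp add: linear_scale[OF linear_L] del: of_nat_Suc)
    ultimately show ?thesis
      using integrable_between_0_indicator[OF h] L_eq_integral_between_0_indicator[OF h]
      by (metis Bochner_Integration.integral_mult_right_zero integrable_mult_right)
  qed
  have incseq: "incseq g"
    by (intro incseq_SucI) (auto simp: g_def le_fun_def inf_min indicator_def)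
  have lim: "(\<lambda>n. g n x) \<longlonglongrightarrow> f x" for x
  proof (rule tendsto_eventually)
    obtain N where "f x \<le> real N" using real_arch_simple by blast
    then show "\<forall>\<^sub>F n in sequentially. g n x = f x"
      using zero_outside[OF f(1), of x]
      by (intro eventually_sequentiallyI[of N]) (auto simp: g_def indicator_def inf_min)
  qed
  have "(\<lambda>n. integral\<^sup>L representing_measure (g n)) \<longlonglongrightarrow> L f"
    using L_tendsto[OF g_in_H f(1) incseq lim] g by simp
  moreover have "mono (\<lambda>n. g n x)" for x using incseq by (simp add: incseq_def mono_def le_fun_def)
  ultimately show ?thesis
    using g lim measurable_H[OF f(1)]
    by (intro has_bochner_integral_monotone_convergence[of _ g]) auto
qed

theorem has_bochner_integral_representing_measure:
  assumes f: "f \<in> H"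
  shows "has_bochner_integral representing_measure f (L f)"
proof -
  have "- f \<in> H" using subspace_neg[OF subspace_H f] .
  then have parts: "sup f 0 \<in> H" "sup (- f) 0 \<in> H" by (intro H_closed f)+
  have "f = sup f 0 - sup (- f) 0" by (auto simp: fun_eq_iff sup_max)
  moreover have "has_bochner_integral representing_measure (sup f 0 - sup (- f) 0)
      (L (sup f 0) - L (sup (- f) 0))"
    unfolding fun_diff_def
    by (intro has_bochner_integral_diff has_bochner_integral_nonneg parts sup_ge2)
  ultimately show ?thesis
    by (metis linear_diff[OF linear_L])
qed

end

section \<open>Lower semicontinuous functions\<close>

definition lower_semicontinuous_on :: "'a::topological_space set \<Rightarrow> ('a \<Rightarrow> ereal) \<Rightarrow> bool" where
  "lower_semicontinuous_on S u \<longleftrightarrow> (\<forall>x\<in>S. \<forall>y<u x. \<forall>\<^sub>F x' in at x within S. y < u x')"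

lemma lower_semicontinuous_on_add_continuous:
  assumes u: "lower_semicontinuous_on S u" and g: "continuous_on S g"
  shows "lower_semicontinuous_on S (\<lambda>x. u x + ereal (g x))"
  unfolding lower_semicontinuous_on_def
proof (intro ballI allI impI)
  fix x y assume x: "x \<in> S" and y: "y < u x + ereal (g x)"
  have lsc: "\<forall>\<^sub>F x' in at x within S. s < u x'" if "s < u x" for s
    using u x that by (auto simp: lower_semicontinuous_on_def)
  show "\<forall>\<^sub>F x' in at x within S. y < u x' + ereal (g x')"
  proof (cases y)
    case (real r)
    have "ereal (r - g x) < u x" using y real by (cases "u x") auto
    then obtain s where s: "r - g x < s" "ereal s < u x" using ereal_dense2 by force
    have "((\<lambda>x'. r - g x') \<longlongrightarrow> r - g x) (at x within S)"
      using g x by (intro tendsto_intros) (auto simp: continuous_on_def)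
    then have "\<forall>\<^sub>F x' in at x within S. r - g x' < s" using s(1) by (rule order_tendstoD(2))
    with lsc[OF s(2)] show ?thesis
    proof eventually_elim
      case (elim x')
      then show ?case by (cases "u x'") (auto simp: real)
    qed
  next
    case MInf
    then have "-\<infinity> < u x" using y by auto
    from lsc[OF this] show ?thesis
    proof eventually_elim
      case (elim x')
      then show ?case by (cases "u x'") (auto simp: MInf)
    qed
  qed (use y in auto)
qed

definition truncation :: "('a \<Rightarrow> ereal) \<Rightarrow> nat \<Rightarrow> 'a \<Rightarrow> real" where
  "truncation u n y = real_of_ereal (min (u y) (ereal (real n)))"

definition lipschitz_envelope :: "'a::metric_space set \<Rightarrow> ('a \<Rightarrow> ereal) \<Rightarrow> nat \<Rightarrow> 'a \<Rightarrow> real" where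
  "lipschitz_envelope S u n x = (INF y\<in>S. truncation u n y + real n * dist x y)"

context
  fixes S :: "'a::metric_space set" and u :: "'a \<Rightarrow> ereal"
  assumes nonempty: "S \<noteq> {}" and nonneg: "\<forall>x\<in>S. 0 \<le> u x"
begin

lemma ereal_truncation: "y \<in> S \<Longrightarrow> ereal (truncation u n y) = min (u y) (ereal (real n))"
  unfolding truncation_def using nonneg by (cases "u y") (auto simp: min_def)

lemma truncation_nonneg: "y \<in> S \<Longrightarrow> 0 \<le> truncation u n y"
  unfolding truncation_def using nonneg by (intro real_of_ereal_pos) simp

lemma lipschitz_envelope_le:
  "y \<in> S \<Longrightarrow> lipschitz_envelope S u n x \<le> truncation u n y + real n * dist x y"
  unfolding lipschitz_envelope_def
  by (rule cINF_lower) (auto intro!: bdd_belowI[of _ 0] add_nonneg_nonneg truncation_nonneg)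

lemma le_lipschitz_envelope:
  "(\<And>y. y \<in> S \<Longrightarrow> b \<le> truncation u n y + real n * dist x y) \<Longrightarrow> b \<le> lipschitz_envelope S u n x"
  unfolding lipschitz_envelope_def by (rule cINF_greatest[OF nonempty])

lemma lipschitz_envelope_nonneg: "0 \<le> lipschitz_envelope S u n x"
  by (intro le_lipschitz_envelope add_nonneg_nonneg truncation_nonneg) simp_all

lemma ereal_lipschitz_envelope_le:
  "x \<in> S \<Longrightarrow> ereal (lipschitz_envelope S u n x) \<le> min (u x) (ereal (real n))"
  using lipschitz_envelope_le[of x n x] by (subst ereal_truncation[symmetric]) simp_all

lemma lipschitz_on_lipschitz_envelope: "(real n)-lipschitz_on UNIV (lipschitz_envelope S u n)"
proof (rule lipschitz_onI)
  have one_sided: "lipschitz_envelope S u n x - real n * dist x x' \<le> lipschitz_envelope S u n x'"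
    for x x'
  proof (rule le_lipschitz_envelope)
    fix y assume "y \<in> S"
    then have "lipschitz_envelope S u n x \<le> truncation u n y + real n * dist x y"
      by (rule lipschitz_envelope_le)
    also have "\<dots> \<le> truncation u n y + real n * (dist x x' + dist x' y)"
      by (intro add_left_mono mult_left_mono dist_triangle) simp
    finally show "lipschitz_envelope S u n x - real n * dist x x'
        \<le> truncation u n y + real n * dist x' y"
      by (simp add: algebra_simps)
  qed
  show "dist (lipschitz_envelope S u n x) (lipschitz_envelope S u n x') \<le> real n * dist x x'"
    for x x'
    using one_sided[of x x'] one_sided[of x' x] by (auto simp: dist_real_def dist_commute)
qed simp

lemma lipschitz_envelope_Suc_ge: "lipschitz_envelope S u n x \<le> lipschitz_envelope S u (Suc n) x"
proof (rule le_lipschitz_envelope)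
  fix y assume y: "y \<in> S"
  have "ereal (truncation u n y) \<le> ereal (truncation u (Suc n) y)"
    unfolding ereal_truncation[OF y] by (intro min.mono) auto
  then have "truncation u n y \<le> truncation u (Suc n) y" by simp
  moreover have "real n * dist x y \<le> real (Suc n) * dist x y" by (intro mult_right_mono) auto
  ultimately show "lipschitz_envelope S u n x \<le> truncation u (Suc n) y + real (Suc n) * dist x y"
    using lipschitz_envelope_le[OF y, of n x] by linarith
qed

lemma lipschitz_envelope_eventually_ge:
  assumes lsc: "lower_semicontinuous_on S u" and x: "x \<in> S" and r: "0 \<le> r" "ereal r < u x"
  obtains n where "r \<le> lipschitz_envelope S u n x"
proof -
  have "\<forall>\<^sub>F y in at x within S. ereal r < u y"
    using lsc x r(2) by (simp add: lower_semicontinuous_on_def)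
  then obtain \<delta> where \<delta>: "0 < \<delta>" "\<And>y. y \<in> S \<Longrightarrow> y \<noteq> x \<Longrightarrow> dist y x < \<delta> \<Longrightarrow> ereal r < u y"
    by (auto simp: eventually_at)
  obtain n where n: "max r (r / \<delta>) \<le> real n" using real_arch_simple by blast
  have "r \<le> lipschitz_envelope S u n x"
  proof (rule le_lipschitz_envelope)
    fix y assume y: "y \<in> S"
    show "r \<le> truncation u n y + real n * dist x y"
    proof (cases "dist y x < \<delta>")
      case True
      then have "ereal r < u y" using \<delta>(2)[OF y] r(2) by (cases "y = x") auto
      then have "ereal r \<le> ereal (truncation u n y)"
        using n unfolding ereal_truncation[OF y] by simp
      then show ?thesis by (simp add: add_increasing2)
    next
      case False
      have "r \<le> real n * \<delta>" using n \<delta>(1) by (simp add: field_simps)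
      also have "\<dots> \<le> real n * dist x y"
        using False by (intro mult_left_mono) (auto simp: dist_commute)
      finally show ?thesis using truncation_nonneg[OF y, of n] by simp
    qed
  qed
  then show thesis by (rule that)
qed

lemma SUP_lipschitz_envelope:
  assumes lsc: "lower_semicontinuous_on S u" and x: "x \<in> S"
  shows "(SUP n. ereal (lipschitz_envelope S u n x)) = u x"
proof (rule antisym)
  show "(SUP n. ereal (lipschitz_envelope S u n x)) \<le> u x"
    using ereal_lipschitz_envelope_le[OF x] by (intro SUP_least) simp
  show "u x \<le> (SUP n. ereal (lipschitz_envelope S u n x))"
  proof (rule dense_le)
    fix y assume "y < u x"
    then obtain r where r: "y < ereal r" "ereal r < u x" using ereal_dense2 by blast
    obtain n where n: "r \<le> lipschitz_envelope S u n x"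
    proof (cases "0 \<le> r")
      case True
      then show thesis using lipschitz_envelope_eventually_ge[OF lsc x _ r(2)] that by blast
    next
      case False
      then show thesis using that[of 0] lipschitz_envelope_nonneg[of 0 x] by simp
    qed
    have "y \<le> ereal r" using r(1) by simp
    also have "\<dots> \<le> (SUP n. ereal (lipschitz_envelope S u n x))"
      using n by (intro SUP_upper2[of n]) simp_all
    finally show "y \<le> (SUP n. ereal (lipschitz_envelope S u n x))" .
  qed
qed

end

section \<open>Functions dominated by a weight\<close>

definition weighted_bounded :: "'a set \<Rightarrow> ('a \<Rightarrow> real) \<Rightarrow> ('a \<Rightarrow> real) set" where
  "weighted_bounded S w = {g. \<exists>M. \<forall>x\<in>S. \<bar>g x\<bar> \<le> M * w x}"

definition weighted_continuous :: "'a::topological_space set \<Rightarrow> ('a \<Rightarrow> real) \<Rightarrow> ('a \<Rightarrow> real) set" where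
  "weighted_continuous S w =
    {g \<in> weighted_bounded S w. continuous_on S g \<and> (\<forall>x. x \<notin> S \<longrightarrow> g x = 0)}"

definition weighted_bounded_below :: "'a set \<Rightarrow> ('a \<Rightarrow> real) \<Rightarrow> ('a \<Rightarrow> ereal) \<Rightarrow> bool" where
  "weighted_bounded_below S w c \<longleftrightarrow> (\<exists>M. \<forall>x\<in>S. ereal (- M * w x) \<le> c x)"

lemma weighted_boundedI: "(\<And>x. x \<in> S \<Longrightarrow> \<bar>g x\<bar> \<le> M * w x) \<Longrightarrow> g \<in> weighted_bounded S w"
  unfolding weighted_bounded_def by blast

lemma weighted_boundedE:
  assumes "g \<in> weighted_bounded S w"
  obtains M where "\<And>x. x \<in> S \<Longrightarrow> \<bar>g x\<bar> \<le> M * w x"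
  using assms unfolding weighted_bounded_def by blast

lemma weighted_bounded_dominated:
  assumes "f \<in> weighted_bounded S w" "g \<in> weighted_bounded S w"
    and "\<And>x. x \<in> S \<Longrightarrow> \<bar>h x\<bar> \<le> \<bar>f x\<bar> + \<bar>g x\<bar>"
  shows "h \<in> weighted_bounded S w"
proof -
  obtain M where M: "\<And>x. x \<in> S \<Longrightarrow> \<bar>f x\<bar> \<le> M * w x" using weighted_boundedE[OF assms(1)] by blast
  obtain M' where M': "\<And>x. x \<in> S \<Longrightarrow> \<bar>g x\<bar> \<le> M' * w x" using weighted_boundedE[OF assms(2)] by blast
  have "\<bar>h x\<bar> \<le> (M + M') * w x" if "x \<in> S" for x
    using assms(3) M M' that by (fastforce simp: distrib_right)
  then show ?thesis by (rule weighted_boundedI)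
qed

lemma subspace_weighted_bounded: "subspace (weighted_bounded S w)"
proof (rule subspaceI)
  show "0 \<in> weighted_bounded S w" by (rule weighted_boundedI[of _ _ 0]) simp
  show "f + g \<in> weighted_bounded S w"
    if "f \<in> weighted_bounded S w" "g \<in> weighted_bounded S w" for f g
    using that by (rule weighted_bounded_dominated) simp
  fix c :: real and f :: "'a \<Rightarrow> real" assume "f \<in> weighted_bounded S w"
  then obtain M where M: "\<And>x. x \<in> S \<Longrightarrow> \<bar>f x\<bar> \<le> M * w x" by (rule weighted_boundedE) blast
  have "\<bar>(c *\<^sub>R f) x\<bar> \<le> (\<bar>c\<bar> * M) * w x" if "x \<in> S" for x
    using mult_left_mono[OF M[OF that] abs_ge_zero[of c]] by (simp add: abs_mult mult.assoc)
  then show "c *\<^sub>R f \<in> weighted_bounded S w" by (rule weighted_boundedI)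
qed

lemma weighted_bounded_below_add:
  assumes c: "weighted_bounded_below S w c" and g: "g \<in> weighted_bounded S w"
  shows "weighted_bounded_below S w (\<lambda>x. c x + ereal (g x))"
proof -
  obtain M where M: "\<And>x. x \<in> S \<Longrightarrow> ereal (- M * w x) \<le> c x"
    using c by (auto simp: weighted_bounded_below_def)
  obtain M' where M': "\<And>x. x \<in> S \<Longrightarrow> \<bar>g x\<bar> \<le> M' * w x"
    using weighted_boundedE[OF g] by blast
  have "ereal (- (M + M') * w x) \<le> c x + ereal (g x)" if "x \<in> S" for x
    using M[OF that] M'[OF that] by (cases "c x") (auto simp: algebra_simps)
  then show ?thesis unfolding weighted_bounded_below_def by blast
qed

lemma weighted_bounded_below_ereal:
  assumes "g \<in> weighted_bounded S w"
  shows "weighted_bounded_below S w (\<lambda>x. ereal (g x))"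
proof -
  have "weighted_bounded_below S w (\<lambda>x. 0)"
    unfolding weighted_bounded_below_def by (intro exI[of _ 0]) simp
  from weighted_bounded_below_add[OF this assms] show ?thesis by simp
qed

lemma weighted_continuous_subset: "weighted_continuous S w \<subseteq> weighted_bounded S w"
  by (auto simp: weighted_continuous_def)

lemma subspace_weighted_continuous: "subspace (weighted_continuous S w)"
  using subspace_weighted_bounded[of S w]
  by (auto simp: subspace_def weighted_continuous_def plus_fun_def scaleR_fun_def zero_fun_def
      intro!: continuous_intros)

lemma sup_weighted_continuous:
  assumes "f \<in> weighted_continuous S w" "g \<in> weighted_continuous S w"
  shows "sup f g \<in> weighted_continuous S w"
proof -
  have "sup f g \<in> weighted_bounded S w"
  proof (rule weighted_bounded_dominated)
    show "f \<in> weighted_bounded S w" "g \<in> weighted_bounded S w"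
      using assms weighted_continuous_subset by blast+
  qed (auto simp: sup_max max_def)
  moreover have "continuous_on S (sup f g)"
    using assms unfolding sup_fun_def sup_max
    by (intro continuous_intros) (auto simp: weighted_continuous_def)
  ultimately show ?thesis using assms by (auto simp: weighted_continuous_def)
qed

lemma indicator_mult_weighted_continuous:
  assumes "continuous_on S g" "g \<in> weighted_bounded S w"
  shows "(\<lambda>x. indicator S x * g x) \<in> weighted_continuous S w"
proof -
  have "continuous_on S (\<lambda>x. indicator S x * g x)"
    using assms(1) by (rule continuous_on_eq) simp
  moreover have "(\<lambda>x. indicator S x * g x) \<in> weighted_bounded S w"
    using assms(2) by (auto simp: weighted_bounded_def)
  ultimately show ?thesis by (simp add: weighted_continuous_def)
qed

theorem Dini:
  fixes g :: "nat \<Rightarrow> 'a::topological_space \<Rightarrow> real"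
  assumes S: "compact S" and g: "\<And>n. continuous_on S (g n)" and l: "continuous_on S l"
    and decseq: "\<And>x. x \<in> S \<Longrightarrow> decseq (\<lambda>n. g n x)" and lim: "\<And>x. x \<in> S \<Longrightarrow> (\<lambda>n. g n x) \<longlonglongrightarrow> l x"
  shows "uniform_limit S g l sequentially"
proof (rule uniform_limitI)
  fix e :: real assume e: "0 < e"
  have "\<exists>V. open V \<and> V \<inter> S = (\<lambda>x. g n x - l x) -` {..<e} \<inter> S" for n
    using continuous_on_diff[OF g l, of n] by (auto simp: continuous_on_open_invariant)
  then obtain V where V: "\<And>n. open (V n)" "\<And>n. V n \<inter> S = (\<lambda>x. g n x - l x) -` {..<e} \<inter> S"
    by metis
  have "S \<subseteq> (\<Union>n. V n)"
  proof
    fix x assume x: "x \<in> S"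
    have "(\<lambda>n. g n x - l x) \<longlonglongrightarrow> 0" using lim[OF x] by (simp add: LIM_zero)
    from order_tendstoD(2)[OF this e] obtain n where "g n x - l x < e"
      by (auto simp: eventually_sequentially)
    with x V(2)[of n] show "x \<in> (\<Union>n. V n)" by blast
  qed
  then obtain C where C: "finite C" "S \<subseteq> (\<Union>n\<in>C. V n)"
    using compactE_image[OF S, of UNIV V] V(1) by auto
  have "dist (g n x) (l x) < e" if n: "Max (insert 0 C) \<le> n" and x: "x \<in> S" for n x
  proof -
    obtain m where m: "m \<in> C" "x \<in> V m" using C x by blast
    then have "m \<le> n" using n C(1) by (meson Max_ge finite_insert insertCI order_trans)
    then have "g n x \<le> g m x" using decseq[OF x] by (simp add: decseq_def)
    moreover have "g m x - l x < e" using V(2)[of m] m x by blast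
    moreover have "l x \<le> g n x" using decseq_ge[OF decseq[OF x] lim[OF x]] .
    ultimately show ?thesis by (simp add: dist_real_def)
  qed
  then show "\<forall>\<^sub>F n in sequentially. \<forall>x\<in>S. dist (g n x) (l x) < e"
    by (intro eventually_sequentiallyI[of "Max (insert 0 C)"]) blast
qed

locale weighted_space =
  fixes S :: "'a::metric_space set" and w :: "'a \<Rightarrow> real"
  assumes weight_ge_1: "\<And>x. x \<in> S \<Longrightarrow> 1 \<le> w x"
    and continuous_weight: "continuous_on S w"
    and compact_sublevel: "\<And>R. compact {x \<in> S. w x \<le> R}"
begin

abbreviation C :: "('a \<Rightarrow> real) set" where
  "C \<equiv> weighted_continuous S w"

lemmas C_closed = subspace_0[OF subspace_weighted_continuous]
  subspace_add[OF subspace_weighted_continuous]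
  subspace_diff[OF subspace_weighted_continuous] subspace_scale[OF subspace_weighted_continuous]
  subspace_sum[OF subspace_weighted_continuous] subspace_neg[OF subspace_weighted_continuous]

lemma weighted_boundedE_pos:
  assumes "g \<in> weighted_bounded S w"
  obtains M where "0 < M" "\<And>x. x \<in> S \<Longrightarrow> \<bar>g x\<bar> \<le> M * w x"
proof -
  obtain M where M: "\<And>x. x \<in> S \<Longrightarrow> \<bar>g x\<bar> \<le> M * w x" using weighted_boundedE[OF assms] by blast
  have "\<bar>g x\<bar> \<le> max 1 M * w x" if "x \<in> S" for x
    using M[OF that] weight_ge_1[OF that] by (elim order_trans) (auto intro: mult_right_mono)
  then show thesis by (intro that[of "max 1 M"]) auto
qed

lemma weight_weighted_bounded: "w \<in> weighted_bounded S w"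
  using weight_ge_1 by (intro weighted_boundedI[of _ _ 1]) force

lemma indicator_in_C: "indicator S \<in> C"
  using indicator_mult_weighted_continuous[OF continuous_on_const weighted_boundedI, of S 1 1 w]
    weight_ge_1
  by simp

lemma weight_in_C: "(\<lambda>x. indicator S x * w x) \<in> C"
  by (rule indicator_mult_weighted_continuous[OF continuous_weight weight_weighted_bounded])

lemma domain_in_borel: "S \<in> sets borel"
proof -
  have "S = (\<Union>n::nat. {x \<in> S. w x \<le> real n})" using real_arch_simple by blast
  also have "\<dots> \<in> sets borel" using compact_sublevel by (auto intro: borel_compact)
  finally show ?thesis .
qed

lemma C_measurable:
  assumes "g \<in> C"
  shows "g \<in> borel_measurable borel"
proof -
  have "(\<lambda>x. indicator S x *\<^sub>R g x) \<in> borel_measurable borel"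
    using assms domain_in_borel
    by (intro borel_measurable_continuous_on_indicator) (auto simp: weighted_continuous_def)
  also have "(\<lambda>x. indicator S x *\<^sub>R g x) = g"
    using assms by (auto simp: weighted_continuous_def indicator_def fun_eq_iff)
  finally show ?thesis .
qed

lemma C_positivity_set:
  assumes "open G"
  shows "\<exists>h\<in>C. 0 \<le> h \<and> {x. 0 < h x} = G \<inter> S"
proof (cases "G = UNIV")
  case True
  then show ?thesis
    by (intro bexI[OF _ indicator_in_C]) (auto simp: le_fun_def indicator_def split: if_splits)
next
  case False
  let ?h = "\<lambda>x. indicator S x * min 1 (infdist x (- G))"
  have "?h \<in> C"
    using weight_ge_1
    by (intro indicator_mult_weighted_continuous weighted_boundedI[of _ _ 1] continuous_intros)
      (auto simp: infdist_nonneg min.coboundedI1)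
  moreover have "0 < infdist x (- G) \<longleftrightarrow> x \<in> G" for x
    using in_closed_iff_infdist_zero[of "- G" x] assms False infdist_nonneg[of x "- G"]
    by (auto simp: closed_def less_le)
  ultimately show ?thesis
    by (intro bexI[of _ ?h]) (auto simp: le_fun_def infdist_nonneg indicator_def split: if_splits)
qed

lemma nonneg_lower_semicontinuous_approximation:
  assumes lsc: "lower_semicontinuous_on S u" and nonneg: "\<forall>x\<in>S. 0 \<le> u x"
    and nonempty: "S \<noteq> {}"
  obtains v where "\<And>n. v n \<in> C" "incseq v" "\<And>x. x \<in> S \<Longrightarrow> (SUP n. ereal (v n x)) = u x"
proof -
  note envelope = lipschitz_on_lipschitz_envelope[OF nonempty nonneg]
    lipschitz_envelope_nonneg[OF nonempty nonneg]
    ereal_lipschitz_envelope_le[OF nonempty nonneg]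
    lipschitz_envelope_Suc_ge[OF nonempty nonneg]
    SUP_lipschitz_envelope[OF nonempty nonneg lsc]
  let ?v = "\<lambda>n x. indicator S x * lipschitz_envelope S u n x"
  have "?v n \<in> C" for n
  proof (rule indicator_mult_weighted_continuous)
    show "continuous_on S (lipschitz_envelope S u n)"
      using envelope(1) by (auto intro: lipschitz_on_continuous_on continuous_on_subset)
    show "lipschitz_envelope S u n \<in> weighted_bounded S w"
    proof (rule weighted_boundedI)
      fix x assume x: "x \<in> S"
      have "\<bar>lipschitz_envelope S u n x\<bar> \<le> real n" using envelope(2,3) x by simp
      also have "\<dots> \<le> real n * w x" using weight_ge_1[OF x] by (simp add: mult_le_cancel_left1)
      finally show "\<bar>lipschitz_envelope S u n x\<bar> \<le> real n * w x" .
    qed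
  qed
  moreover have "incseq ?v"
    by (intro incseq_SucI le_funI mult_left_mono envelope(4) indicator_pos_le)
  moreover have "(SUP n. ereal (?v n x)) = u x" if "x \<in> S" for x
    using envelope(5)[OF that] that by simp
  ultimately show thesis by (rule that)
qed

lemma lower_semicontinuous_approximation:
  assumes lsc: "lower_semicontinuous_on S c" and below: "weighted_bounded_below S w c"
    and nonempty: "S \<noteq> {}"
  obtains h where "\<And>n. h n \<in> C" "incseq h" "\<And>x. x \<in> S \<Longrightarrow> (SUP n. ereal (h n x)) = c x"
proof -
  obtain M where M: "\<And>x. x \<in> S \<Longrightarrow> ereal (- M * w x) \<le> c x"
    using below by (auto simp: weighted_bounded_below_def)
  define u where "u x = c x + ereal (M * w x)" for x
  have "0 \<le> u x" if "x \<in> S" for x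
    using M[OF that] by (cases "c x") (auto simp: u_def)
  then have "\<forall>x\<in>S. 0 \<le> u x" ..
  moreover have "lower_semicontinuous_on S u"
    unfolding u_def[abs_def]
    by (intro lower_semicontinuous_on_add_continuous lsc continuous_intros continuous_weight)
  ultimately obtain v where v: "\<And>n. v n \<in> C" "incseq v"
    and SUP_v: "\<And>x. x \<in> S \<Longrightarrow> (SUP n. ereal (v n x)) = u x"
    using nonneg_lower_semicontinuous_approximation[OF _ _ nonempty] by blast
  define h where "h n = v n - M *\<^sub>R (\<lambda>x. indicator S x * w x)" for n
  have "h n \<in> C" for n
    unfolding h_def by (intro C_closed weight_in_C v)
  moreover have "incseq h"
    unfolding h_def by (intro incseq_SucI diff_right_mono) (rule incseq_SucD[OF v(2)])
  moreover have "(SUP n. ereal (h n x)) = c x" if x: "x \<in> S" for x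
  proof -
    have "(SUP n. ereal (h n x)) = (SUP n. ereal (v n x) + ereal (- M * w x))"
      using x by (simp add: h_def)
    also have "\<dots> = u x + ereal (- M * w x)"
      by (subst SUP_ereal_add_left) (simp_all add: SUP_v[OF x])
    also have "\<dots> = c x" by (cases "c x") (auto simp: u_def)
    finally show ?thesis .
  qed
  ultimately show thesis by (rule that)
qed

lemma eventually_le_majorant:
  assumes g: "\<And>n. g n \<in> C" "decseq g" "\<And>x. (\<lambda>n. g n x) \<longlonglongrightarrow> 0"
    and B: "0 \<le> B" "\<And>x. x \<in> S \<Longrightarrow> g 0 x \<le> B * w x"
    and F: "0 \<le> F" "\<And>x. x \<in> S \<Longrightarrow> R < w x \<Longrightarrow> w x \<le> F x" and e: "0 < e"
  shows "\<forall>\<^sub>F n in sequentially. g n \<le> B *\<^sub>R F + e *\<^sub>R indicator S"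
proof -
  have decseq: "decseq (\<lambda>n. g n x)" for x
    using decseqD[OF g(2), THEN le_funD] by (simp add: decseq_def)
  have majorant_nonneg: "0 \<le> B * F x" for x using F(1) B(1) by (simp add: le_fun_def)
  have "uniform_limit {x \<in> S. w x \<le> R} g (\<lambda>_. 0) sequentially"
    using g(1,3) decseq
    by (intro Dini compact_sublevel)
      (auto simp: weighted_continuous_def intro: continuous_on_subset)
  then have "\<forall>\<^sub>F n in sequentially. \<forall>x\<in>{x \<in> S. w x \<le> R}. dist (g n x) 0 < e"
    using e by (rule uniform_limitD)
  then show ?thesis
  proof (eventually_elim, intro le_funI)
    fix n x
    assume small: "\<forall>x\<in>{x \<in> S. w x \<le> R}. dist (g n x) 0 < e"
    consider (outside) "x \<notin> S" | (sublevel) "x \<in> S" "w x \<le> R" | (tail) "x \<in> S" "R < w x" by linarith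
    then show "g n x \<le> (B *\<^sub>R F + e *\<^sub>R indicator S) x"
    proof cases
      case outside
      then show ?thesis using g(1)[of n] majorant_nonneg[of x] by (simp add: weighted_continuous_def)
    next
      case sublevel
      then have "g n x \<le> e" using small by (fastforce simp: dist_real_def)
      then show ?thesis using sublevel(1) majorant_nonneg[of x] by simp
    next
      case tail
      have "g n x \<le> g 0 x" using decseqD[OF decseq, of 0 n] by simp
      also have "\<dots> \<le> B * w x" by (rule B(2)[OF tail(1)])
      also have "\<dots> \<le> B * F x" by (intro mult_left_mono F(2) B(1) tail)
      finally show ?thesis using e tail(1) by simp
    qed
  qed
qed

end

locale tight_functional = weighted_space S w
  for S :: "'a::metric_space set" and w :: "'a \<Rightarrow> real" +
  fixes L :: "('a \<Rightarrow> real) \<Rightarrow> real"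
  assumes linear_L: "linear L"
    and L_nonneg: "\<And>g. g \<in> C \<Longrightarrow> 0 \<le> g \<Longrightarrow> 0 \<le> L g"
    and L_indicator: "L (indicator S) = 1"
    and tight: "\<And>e. 0 < e \<Longrightarrow> \<exists>F\<in>C. \<exists>R. 0 \<le> F \<and> (\<forall>x\<in>S. R < w x \<longrightarrow> w x \<le> F x) \<and> L F \<le> e"
begin

lemma L_tendsto_0:
  assumes g: "\<And>n. g n \<in> C" and decseq: "decseq g" and lim: "\<And>x. (\<lambda>n. g n x) \<longlonglongrightarrow> 0"
  shows "(\<lambda>n. L (g n)) \<longlonglongrightarrow> 0"
proof (rule tendstoI)
  fix r :: real assume r: "0 < r"
  have "decseq (\<lambda>n. g n x)" for x using decseqD[OF decseq, THEN le_funD] by (simp add: decseq_def)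
  then have g_nonneg: "0 \<le> g n" for n using decseq_ge[OF _ lim] by (simp add: le_fun_def)
  obtain B where B: "0 < B" "\<And>x. x \<in> S \<Longrightarrow> \<bar>g 0 x\<bar> \<le> B * w x"
    using weighted_boundedE_pos[OF subsetD[OF weighted_continuous_subset g]] by blast
  obtain F R where F: "F \<in> C" "0 \<le> F" "\<And>x. x \<in> S \<Longrightarrow> R < w x \<Longrightarrow> w x \<le> F x" "L F \<le> r / (4 * B)"
    using tight[of "r / (4 * B)"] B r by auto
  have "\<forall>\<^sub>F n in sequentially. g n \<le> B *\<^sub>R F + (r / 4) *\<^sub>R indicator S"
    using B r by (intro eventually_le_majorant g decseq lim F) (auto dest: abs_le_D1)
  then show "\<forall>\<^sub>F n in sequentially. dist (L (g n)) 0 < r"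
  proof eventually_elim
    case (elim n)
    then have "0 \<le> L (B *\<^sub>R F + (r / 4) *\<^sub>R indicator S - g n)"
      by (intro L_nonneg C_closed F g indicator_in_C) simp
    then have "L (g n) \<le> B * L F + r / 4"
      by (simp add: linear_diff[OF linear_L] linear_add[OF linear_L] linear_scale[OF linear_L]
          L_indicator)
    also have "\<dots> \<le> B * (r / (4 * B)) + r / 4"
      using F(4) B(1) by (intro add_right_mono mult_left_mono) auto
    also have "\<dots> < r" using B(1) r by simp
    finally show ?case using L_nonneg[OF g g_nonneg, of n] by simp
  qed
qed

sublocale daniell_functional C L S
proof (rule daniell_functional.intro)
  show "f x = 0" if "f \<in> C" "x \<notin> S" for f x using that by (simp add: weighted_continuous_def)
qed (fact subspace_weighted_continuous sup_weighted_continuous indicator_in_C C_measurable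
    C_positivity_set linear_L L_nonneg L_indicator L_tendsto_0)+

end

section \<open>Expectations of extended real functions\<close>

lemma ExpQ_mono_AE:
  assumes "AE x in Q. c x \<le> c' x"
  shows "ExpQ Q c \<le> ExpQ Q c'"
  unfolding ExpQ_def
proof (rule ereal_minus_mono)
  show "enn2ereal (\<integral>\<^sup>+ x. e2ennreal (c x) \<partial>Q) \<le> enn2ereal (\<integral>\<^sup>+ x. e2ennreal (c' x) \<partial>Q)"
    unfolding less_eq_ennreal.rep_eq[symmetric]
    by (rule nn_integral_mono_AE) (use assms in eventually_elim, rule e2ennreal_mono)
  show "enn2ereal (\<integral>\<^sup>+ x. e2ennreal (- c' x) \<partial>Q) \<le> enn2ereal (\<integral>\<^sup>+ x. e2ennreal (- c x) \<partial>Q)"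
    unfolding less_eq_ennreal.rep_eq[symmetric]
    by (rule nn_integral_mono_AE) (use assms in eventually_elim, simp add: e2ennreal_mono)
qed

lemma ExpQ_ereal:
  assumes "integrable Q g"
  shows "ExpQ Q (\<lambda>x. ereal (g x)) = ereal (integral\<^sup>L Q g)"
proof -
  have "(\<integral>\<^sup>+ x. ennreal (g x) \<partial>Q) \<noteq> \<infinity>" "(\<integral>\<^sup>+ x. ennreal (- g x) \<partial>Q) \<noteq> \<infinity>"
    using assms by (auto simp: real_integrable_def)
  then show ?thesis
    unfolding ExpQ_def real_lebesgue_integral_def[OF assms]
    by (cases "\<integral>\<^sup>+ x. ennreal (g x) \<partial>Q" rule: ennreal_cases;
        cases "\<integral>\<^sup>+ x. ennreal (- g x) \<partial>Q" rule: ennreal_cases) simp_all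
qed

lemma e2ennreal_SUP_incseq:
  assumes "incseq h"
  shows "e2ennreal (SUP n. ereal (h n)) = (SUP n. ennreal (h n))"
    and "e2ennreal (- (SUP n. ereal (h n))) = (INF n. ennreal (- h n))"
proof -
  have lim: "(\<lambda>n. ereal (h n)) \<longlonglongrightarrow> (SUP n. ereal (h n))"
    using assms by (intro LIMSEQ_SUP) (simp add: incseq_def)
  show "e2ennreal (SUP n. ereal (h n)) = (SUP n. ennreal (h n))"
    by (rule LIMSEQ_unique[OF tendsto_e2ennrealI[OF lim]])
      (use assms in \<open>auto simp: incseq_def intro!: LIMSEQ_SUP ennreal_leI\<close>)
  show "e2ennreal (- (SUP n. ereal (h n))) = (INF n. ennreal (- h n))"
    by (rule LIMSEQ_unique[OF tendsto_e2ennrealI[OF tendsto_uminus_ereal[OF lim]]])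
      (use assms in \<open>auto simp: incseq_def decseq_def intro!: LIMSEQ_INF ennreal_leI\<close>)
qed

lemma ExpQ_monotone_convergence:
  assumes h: "\<And>n. integrable Q (h n)" and incseq: "incseq h"
    and SUP: "AE x in Q. (SUP n. ereal (h n x)) = c x"
  shows "(\<lambda>n. ereal (integral\<^sup>L Q (h n))) \<longlonglongrightarrow> ExpQ Q c"
proof -
  note h_le = incseqD[OF incseq, THEN le_funD]
  then have "incseq (\<lambda>n. h n x)" for x by (simp add: incseq_def)
  note e2ennreal_SUP = e2ennreal_SUP_incseq[OF this]
  have inc: "incseq (\<lambda>n x. ennreal (h n x))" and dec: "decseq (\<lambda>n x. ennreal (- h n x))"
    by (auto intro!: incseq_SucI decseq_SucI ennreal_leI le_funI h_le)
  have finite: "(\<integral>\<^sup>+ x. ennreal (- h n x) \<partial>Q) < \<infinity>" for n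
    using h by (auto simp: real_integrable_def less_top)
  have "(\<integral>\<^sup>+ x. e2ennreal (c x) \<partial>Q) = (\<integral>\<^sup>+ x. (SUP n. ennreal (h n x)) \<partial>Q)"
    by (intro nn_integral_cong_AE) (use SUP in eventually_elim, metis e2ennreal_SUP(1))
  also have "\<dots> = (SUP n. \<integral>\<^sup>+ x. ennreal (h n x) \<partial>Q)"
    using inc h by (intro nn_integral_monotone_convergence_SUP) auto
  finally have pos: "(\<integral>\<^sup>+ x. e2ennreal (c x) \<partial>Q) = (SUP n. \<integral>\<^sup>+ x. ennreal (h n x) \<partial>Q)" .
  have "(\<integral>\<^sup>+ x. e2ennreal (- c x) \<partial>Q) = (\<integral>\<^sup>+ x. (INF n. ennreal (- h n x)) \<partial>Q)"
    by (intro nn_integral_cong_AE) (use SUP in eventually_elim, metis e2ennreal_SUP(2))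
  also have "\<dots> = (INF n. \<integral>\<^sup>+ x. ennreal (- h n x) \<partial>Q)"
    using dec h finite by (intro nn_integral_monotone_convergence_INF_decseq) auto
  finally have neg: "(\<integral>\<^sup>+ x. e2ennreal (- c x) \<partial>Q) = (INF n. \<integral>\<^sup>+ x. ennreal (- h n x) \<partial>Q)" .
  have "(INF n. \<integral>\<^sup>+ x. ennreal (- h n x) \<partial>Q) < \<infinity>"
    using finite[of 0] by (subst INF_less_iff) blast
  then have "(\<lambda>n. ExpQ Q (\<lambda>x. ereal (h n x))) \<longlonglongrightarrow> ExpQ Q c"
    unfolding ExpQ_def pos neg
    by (intro tendsto_diff_ereal_general tendsto_enn2erealI)
      (auto intro!: LIMSEQ_SUP LIMSEQ_INF incseq_SucI decseq_SucI nn_integral_mono ennreal_leI h_le)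
  then show ?thesis by (simp add: ExpQ_ereal[OF h])
qed

section \<open>Concavity\<close>

lemma ereal_mult_le_of_less:
  fixes a y :: ereal
  assumes l: "0 < l" and a: "a \<noteq> -\<infinity>" and bound: "\<And>r. ereal r < a \<Longrightarrow> ereal (l * r) \<le> y"
  shows "ereal l * a \<le> y"
proof (cases a)
  case (real x)
  have "ereal (l * x) \<le> y"
  proof (rule ereal_le_epsilon2)
    fix e :: real assume "0 < e"
    then have "ereal (l * (x - e / l)) \<le> y" using l real by (intro bound) simp
    then show "ereal (l * x) \<le> y + ereal e" using l by (cases y) (auto simp: algebra_simps)
  qed
  then show ?thesis using real by simp
next
  case PInf
  have "y = \<infinity>"
  proof (rule ereal_top)
    show "ereal B \<le> y" for B using bound[of "B / l"] l PInf by simp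
  qed
  then show ?thesis by simp
qed (use a in simp)

lemma ereal_convex_combination_le_of_less:
  fixes a b y :: ereal
  assumes l: "0 < l" "l < 1" and a: "a \<noteq> -\<infinity>" and b: "b \<noteq> -\<infinity>"
    and bound: "\<And>r s. ereal r < a \<Longrightarrow> ereal s < b \<Longrightarrow> ereal (l * r + (1 - l) * s) \<le> y"
  shows "ereal l * a + ereal (1 - l) * b \<le> y"
proof -
  have mult_left_le: "ereal l * a \<le> y - ereal ((1 - l) * s)" if s: "ereal s < b" for s
  proof (rule ereal_mult_le_of_less[OF l(1) a])
    show "ereal (l * r) \<le> y - ereal ((1 - l) * s)" if "ereal r < a" for r
      using bound[OF that s] by (cases y) auto
  qed
  show ?thesis
  proof (cases "ereal l * a")
    case (real t)
    have "ereal (1 - l) * b \<le> y - ereal t"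
    proof (rule ereal_mult_le_of_less[OF _ b])
      show "ereal ((1 - l) * s) \<le> y - ereal t" if "ereal s < b" for s
        using mult_left_le[OF that] unfolding real by (cases y) auto
    qed (use l in simp)
    then show ?thesis unfolding real by (cases y; cases "ereal (1 - l) * b") auto
  next
    case PInf
    obtain s where "ereal s < b" using b by (metis ereal_dense2 ereal_infty_less(2))
    from mult_left_le[OF this] have "y = \<infinity>" unfolding PInf by (cases y) auto
    then show ?thesis by simp
  next
    case MInf
    then show ?thesis using l a by (cases a) auto
  qed
qed

lemma concave_mono_dist_le:
  fixes p :: "('a \<Rightarrow> real) \<Rightarrow> real"
  assumes X: "subspace X" and concave: "concave_on X p"
    and mono: "\<And>f g. f \<in> X \<Longrightarrow> g \<in> X \<Longrightarrow> (\<And>x. x \<in> S \<Longrightarrow> f x \<le> g x) \<Longrightarrow> p f \<le> p g"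
    and in_X: "f \<in> X" "g \<in> X" "w \<in> X" and \<delta>: "0 \<le> \<delta>" "\<delta> \<le> 1"
    and near: "\<And>x. x \<in> S \<Longrightarrow> \<bar>g x - f x\<bar> \<le> \<delta> * w x"
  shows "\<bar>p g - p f\<bar> \<le> \<delta> * (p f - p (f - w))"
proof -
  note X_closed = subspace_add[OF X] subspace_diff[OF X] subspace_scale[OF X] in_X
  have "(1 - \<delta>) * p f + \<delta> * p (f - w) \<le> p ((1 - \<delta>) *\<^sub>R f + \<delta> *\<^sub>R (f - w))"
    by (intro concave_onD[OF concave \<delta>] X_closed)
  also have "\<dots> \<le> p g"
  proof (rule mono)
    show "((1 - \<delta>) *\<^sub>R f + \<delta> *\<^sub>R (f - w)) x \<le> g x" if "x \<in> S" for x
      using near[OF that] by (simp add: algebra_simps)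
  qed (intro X_closed)+
  finally have lower: "p f - \<delta> * (p f - p (f - w)) \<le> p g"
    by (simp add: algebra_simps)
  define l where "l = \<delta> / (1 + \<delta>)"
  have l: "0 \<le> l" "l \<le> 1" "(1 - l) * \<delta> = l" "(1 + \<delta>) * (1 - l) = 1" "(1 + \<delta>) * l = \<delta>"
    using \<delta> by (auto simp: l_def field_simps)
  have "(1 - l) * p g + l * p (f - w) \<le> p ((1 - l) *\<^sub>R g + l *\<^sub>R (f - w))"
    by (intro concave_onD[OF concave l(1,2)] X_closed)
  also have "\<dots> \<le> p f"
  proof (rule mono)
    fix x assume "x \<in> S"
    then have "(1 - l) * (g x - f x) \<le> (1 - l) * (\<delta> * w x)"
      using near l(2) by (intro mult_left_mono) (auto simp: abs_le_iff)
    also have "\<dots> = l * w x" by (simp only: mult.assoc[symmetric] l(3))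
    finally show "((1 - l) *\<^sub>R g + l *\<^sub>R (f - w)) x \<le> f x" by (simp add: algebra_simps)
  qed (intro X_closed)+
  finally have "(1 + \<delta>) * ((1 - l) * p g + l * p (f - w)) \<le> (1 + \<delta>) * p f"
    using \<delta> by (intro mult_left_mono) auto
  then have "p g + \<delta> * p (f - w) \<le> (1 + \<delta>) * p f"
    by (simp only: distrib_left mult.assoc[symmetric] l(4,5) mult_1)
  with lower show ?thesis by (simp add: algebra_simps abs_le_iff)
qed

section \<open>The path space\<close>

definition path_weight :: "nat \<Rightarrow> nat \<Rightarrow> pt \<Rightarrow> real" where
  "path_weight d t x = 1 + absum d t x"

lemma absum_nonneg: "0 \<le> absum d t x"
  unfolding absum_def by (intro sum_nonneg) auto

lemma path_weight_ge_1: "1 \<le> path_weight d t x"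
  using absum_nonneg[of d t x] by (simp add: path_weight_def)

lemma path_weight_mono: "s \<le> t \<Longrightarrow> path_weight d s x \<le> path_weight d t x"
  unfolding path_weight_def absum_def by (intro add_left_mono sum_mono2) (auto intro: sum_nonneg)

lemma coordinate_le_path_weight:
  assumes "s \<le> t" "j \<in> {1..d}"
  shows "\<bar>x (s, j)\<bar> \<le> path_weight d t x"
proof -
  have "\<bar>x (s, j)\<bar> \<le> (\<Sum>j=1..d. \<bar>x (s, j)\<bar>)"
    using assms by (intro member_le_sum) auto
  also have "\<dots> \<le> absum d t x"
    unfolding absum_def using assms
    by (intro member_le_sum[of s "{..t}" "\<lambda>s. \<Sum>j=1..d. \<bar>x (s, j)\<bar>"]) (auto intro: sum_nonneg)
  finally show ?thesis by (simp add: path_weight_def)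
qed

lemma continuous_on_path_weight: "continuous_on X (path_weight d t)"
  unfolding path_weight_def[abs_def] absum_def
  by (intro continuous_intros continuous_on_product_coordinates[THEN continuous_on_subset]) auto

lemma closed_Omega:
  assumes "\<forall>t\<le>T. \<forall>j\<in>{1..d}. closed (K t j)"
  shows "closed (Omega d T K)"
proof -
  have vimage: "closed ((\<lambda>x :: pt. x i) -` B)" if "closed B" for i B
    by (rule closed_vimage[OF that]) (rule continuous_on_product_coordinates)
  have "Omega d T K = (\<Inter>t\<in>{..T}. \<Inter>j\<in>{1..d}. (\<lambda>x. x (t, j)) -` K t j) \<inter>
      (\<Inter>i\<in>{(t, j). T < t \<or> j \<notin> {1..d}}. (\<lambda>x. x i) -` {0})"
    by (auto simp: Omega_def)
  also have "closed \<dots>"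
    using assms by (intro closed_Int closed_INT ballI vimage) auto
  finally show ?thesis .
qed

lemma compact_Omega_sublevel:
  assumes "closed (Omega d T K)"
  shows "compact {x \<in> Omega d T K. path_weight d T x \<le> R}" (is "compact ?X")
proof -
  let ?B = "PiE UNIV (\<lambda>i :: nat \<times> nat. {- \<bar>R\<bar>..\<bar>R\<bar>})"
  have "compactin (product_topology (\<lambda>i. euclidean) UNIV) ?B"
    by (subst compactin_PiE) auto
  then have "compact ?B" by (simp add: euclidean_product_topology)
  moreover have "closed ?X"
    by (rule closed_Collect_conj)
      (auto simp: assms intro!: closed_Collect_le continuous_on_path_weight)
  ultimately have "compact (?B \<inter> ?X)" by (rule compact_Int_closed)
  moreover have "?X \<subseteq> ?B"
  proof
    fix x assume x: "x \<in> ?X"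
    have "\<bar>x (t, j)\<bar> \<le> \<bar>R\<bar>" for t j
    proof (cases "t \<le> T \<and> j \<in> {1..d}")
      case True
      then show ?thesis using coordinate_le_path_weight[of t T j d x] x by auto
    next
      case False
      then have "x (t, j) = 0" using x by (auto simp: Omega_def)
      then show ?thesis by simp
    qed
    then show "x \<in> ?B" by (auto simp: abs_le_iff minus_le_iff)
  qed
  ultimately show ?thesis by (simp add: inf.absorb2)
qed

lemma weighted_space_Omega:
  assumes "closed (Omega d T K)"
  shows "weighted_space (Omega d T K) (path_weight d T)"
  by standard (rule path_weight_ge_1 continuous_on_path_weight compact_Omega_sublevel[OF assms])+

lemma Cspace_subset_weighted_continuous:
  assumes "t \<le> T"
  shows "Cspace d T K t \<subseteq> weighted_continuous (Omega d T K) (path_weight d T)"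
proof
  fix g assume g: "g \<in> Cspace d T K t"
  then obtain M where M: "\<And>x. x \<in> Omega d T K \<Longrightarrow> \<bar>g x\<bar> \<le> M * path_weight d t x"
    unfolding Cspace_def path_weight_def by blast
  have "\<bar>g x\<bar> \<le> \<bar>M\<bar> * path_weight d T x" if "x \<in> Omega d T K" for x
  proof -
    have "M * path_weight d t x \<le> \<bar>M\<bar> * path_weight d T x"
      using path_weight_mono[OF assms, of d x] path_weight_ge_1[of d t x] by (intro mult_mono) auto
    with M[OF that] show ?thesis by linarith
  qed
  then have "g \<in> weighted_bounded (Omega d T K) (path_weight d T)" by (rule weighted_boundedI)
  moreover have "continuous_on (Omega d T K) g" "\<forall>x. x \<notin> Omega d T K \<longrightarrow> g x = 0"
    using g unfolding Cspace_def by blast+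
  ultimately show "g \<in> weighted_continuous (Omega d T K) (path_weight d T)"
    by (simp add: weighted_continuous_def)
qed

lemma normB_less_imp_le:
  assumes "normB d T K c < ereal \<delta>" "x \<in> Omega d T K"
  shows "\<bar>c x\<bar> \<le> \<delta> * path_weight d T x"
proof -
  have "ereal (\<bar>c x\<bar> / path_weight d T x) \<le> normB d T K c"
    unfolding normB_def path_weight_def by (rule SUP_upper[OF assms(2)])
  also have "\<dots> < ereal \<delta>" by (rule assms)
  finally show ?thesis using path_weight_ge_1[of d T x] by (simp add: divide_less_eq)
qed

lemma Bspace_subset_weighted_bounded:
  "Bspace d T K \<subseteq> weighted_bounded (Omega d T K) (path_weight d T)"
proof
  fix c assume "c \<in> Bspace d T K"
  then have "normB d T K c \<noteq> \<infinity>" by (auto simp: Bspace_def)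
  then obtain n :: nat where "normB d T K c < ereal (real n)" by (metis less_PInf_Ex_of_nat)
  then show "c \<in> weighted_bounded (Omega d T K) (path_weight d T)"
    by (intro weighted_boundedI normB_less_imp_le)
qed

lemma Prob1_AE_Omega:
  assumes Q: "Q \<in> Prob1 d T K" and closed: "closed (Omega d T K)"
  shows "AE x in Q. x \<in> Omega d T K"
proof -
  interpret prob_space Q using Q by (auto simp: Prob1_def)
  have "sets Q = sets borel" "emeasure Q (Omega d T K) = 1" using Q by (auto simp: Prob1_def)
  then show ?thesis using closed by (intro AE_prob_1) (simp add: measure_def)
qed

lemma Prob1_integrable:
  assumes Q: "Q \<in> Prob1 d T K" and closed: "closed (Omega d T K)"
    and g: "g \<in> weighted_continuous (Omega d T K) (path_weight d T)"
  shows "integrable Q g"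
proof -
  interpret weighted_space "Omega d T K" "path_weight d T" by (rule weighted_space_Omega[OF closed])
  interpret prob_space Q using Q by (auto simp: Prob1_def)
  obtain M where M: "0 < M" "\<And>x. x \<in> Omega d T K \<Longrightarrow> \<bar>g x\<bar> \<le> M * path_weight d T x"
    using weighted_boundedE_pos[OF subsetD[OF weighted_continuous_subset g]] by blast
  have "integrable Q (path_weight d T)"
    unfolding path_weight_def[abs_def] absum_def
    using Q
    by (intro Bochner_Integration.integrable_add Bochner_Integration.integrable_sum integrable_abs)
      (auto simp: Prob1_def)
  then have "integrable Q (\<lambda>x. M * path_weight d T x)" by simp
  then show ?thesis
  proof (rule Bochner_Integration.integrable_bound)
    have sets_Q: "sets Q = sets borel" using Q by (auto simp: Prob1_def)
    show "g \<in> borel_measurable Q"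
      unfolding measurable_cong_sets[OF sets_Q refl] by (rule C_measurable[OF g])
    show "AE x in Q. norm (g x) \<le> norm (M * path_weight d T x)"
      using Prob1_AE_Omega[OF Q closed] by eventually_elim (use M in fastforce)
  qed
qed

lemma Prob1I:
  assumes Q: "prob_space Q" "sets Q = sets borel" "emeasure Q (Omega d T K) = 1"
    and closed: "closed (Omega d T K)"
    and weight: "integrable Q (\<lambda>x. indicator (Omega d T K) x * path_weight d T x)"
  shows "Q \<in> Prob1 d T K"
proof -
  interpret prob_space Q by (rule Q)
  have AE_Omega: "AE x in Q. x \<in> Omega d T K"
    using Q closed by (intro AE_prob_1) (simp add: measure_def)
  have "integrable Q (\<lambda>x. x (t, j))" if tj: "t \<le> T" "j \<in> {1..d}" for t j
  proof (rule Bochner_Integration.integrable_bound[OF weight])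
    show "(\<lambda>x. x (t, j)) \<in> borel_measurable Q"
      unfolding measurable_cong_sets[OF Q(2) refl] by (intro borel_measurable_continuous_onI) simp
    show "AE x in Q. norm (x (t, j)) \<le> norm (indicator (Omega d T K) x * path_weight d T x)"
      using AE_Omega
    proof eventually_elim
      case (elim x)
      then show ?case using coordinate_le_path_weight[OF tj, of x] by simp
    qed
  qed
  then show ?thesis using Q by (auto simp: Prob1_def)
qed

section \<open>Nonlinear subhedging\<close>

locale subhedging =
  fixes d T :: nat
    and K :: "nat \<Rightarrow> nat \<Rightarrow> real set"
    and E :: "nat \<Rightarrow> fn set"
    and U :: "(nat \<Rightarrow> fn) \<Rightarrow> ereal"
    and A :: "fn set"
  assumes Kclosed: "\<forall>t\<le>T. \<forall>j\<in>{1..d}. closed (K t j)"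
    and Esub: "\<forall>t\<le>T. E t \<subseteq> Cspace d T K t"
    and Eadd: "\<forall>t\<le>T. \<forall>\<phi>\<in>E t. \<forall>\<psi>\<in>E t. (\<lambda>x. \<phi> x + \<psi> x) \<in> E t"
    and Esmult: "\<forall>t\<le>T. \<forall>\<phi>\<in>E t. \<forall>r::real. (\<lambda>x. r * \<phi> x) \<in> E t"
    and Econst: "\<forall>t\<le>T. \<forall>k::real. cst (Omega d T K) k \<in> E t"
    and Ufin: "\<forall>\<phi>\<in>Ecal T E. U \<phi> < \<infinity>"
    and Uconc: "\<forall>\<phi>\<in>Ecal T E. \<forall>\<psi>\<in>Ecal T E. \<forall>l\<in>{0<..<(1::real)}.
                  ereal l * U \<phi> + ereal (1 - l) * U \<psi>
                  \<le> U (\<lambda>t x. l * \<phi> t x + (1 - l) * \<psi> t x)"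
    and U0: "U (\<lambda>t x. 0) \<noteq> -\<infinity>"
    and Asub: "A \<subseteq> Cspace d T K T"
    and A0: "(\<lambda>x. 0) \<in> A"
    and Acone: "\<forall>a\<in>A. \<forall>b\<in>A. \<forall>r\<ge>0. \<forall>s\<ge>0. (\<lambda>x. r * a x + s * b x) \<in> A"
begin

abbreviation Om :: "pt set" where "Om \<equiv> Omega d T K"
abbreviation w :: fn where "w \<equiv> path_weight d T"
abbreviation P :: "(pt \<Rightarrow> ereal) \<Rightarrow> ereal" where "P \<equiv> Pfrak T Om E U A"
abbreviation total :: "(nat \<Rightarrow> fn) \<Rightarrow> fn" where "total \<phi> \<equiv> (\<Sum>t\<le>T. \<phi> t)"

lemma closed_Om: "closed Om"
  by (rule closed_Omega[OF Kclosed])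

sublocale weighted_space Om w
  by (rule weighted_space_Omega[OF closed_Om])

lemma subspace_Ecal: "subspace (Ecal T E)"
proof (rule subspaceI)
  have "(\<lambda>x. 0) \<in> E t" if "t \<le> T" for t
    using Econst[rule_format, OF that, of 0] by (simp add: cst_def)
  then show "0 \<in> Ecal T E" by (simp add: Ecal_def zero_fun_def)
qed (use Eadd Esmult in \<open>auto simp: Ecal_def plus_fun_def scaleR_fun_def\<close>)

lemma Ecal_component_in_C: "\<phi> \<in> Ecal T E \<Longrightarrow> t \<le> T \<Longrightarrow> \<phi> t \<in> C"
  using Esub Cspace_subset_weighted_continuous[of t T d K] unfolding Ecal_def by blast

lemma total_in_C: "\<phi> \<in> Ecal T E \<Longrightarrow> total \<phi> \<in> C"
  by (intro C_closed) (simp add: Ecal_component_in_C)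

lemma A_subset_C: "A \<subseteq> C"
  using Asub Cspace_subset_weighted_continuous[of T T d K] by simp

lemma A_add: "a \<in> A \<Longrightarrow> b \<in> A \<Longrightarrow> a + b \<in> A"
  using Acone[rule_format, of a b 1 1] by (simp add: plus_fun_def)

lemma A_convex_combination: "a \<in> A \<Longrightarrow> b \<in> A \<Longrightarrow> 0 \<le> r \<Longrightarrow> 0 \<le> s \<Longrightarrow> r *\<^sub>R a + s *\<^sub>R b \<in> A"
  using Acone[rule_format, of a b r s] by (simp add: plus_fun_def scaleR_fun_def)

lemma U_concave:
  assumes "\<phi> \<in> Ecal T E" "\<psi> \<in> Ecal T E" "0 < l" "l < 1"
  shows "ereal l * U \<phi> + ereal (1 - l) * U \<psi> \<le> U (l *\<^sub>R \<phi> + (1 - l) *\<^sub>R \<psi>)"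
  using Uconc[rule_format, of \<phi> \<psi> l] assms by (simp add: plus_fun_def scaleR_fun_def)

lemma shift_in_Ecal: "\<phi> \<in> Ecal T E \<Longrightarrow> shift T Om \<phi> \<beta> \<in> Ecal T E"
  using Eadd Econst unfolding Ecal_def shift_def by auto

lemma sum_shift: "x \<in> Om \<Longrightarrow> (\<Sum>t\<le>T. shift T Om \<phi> \<beta> t x) = (\<Sum>t\<le>T. \<phi> t x) + (\<Sum>t\<le>T. \<beta> t)"
  by (simp add: shift_def cst_def sum.distrib)

text \<open>In terms of the definition of \<open>\<P>(c)\<close>, \<open>\<psi>\<close> is \<open>\<phi> + \<beta>\<close>, \<open>b\<close> is \<open>\<Sum>\<beta>\<^sub>t\<close> and \<open>a\<close> is \<open>-z\<close>.\<close>

definition subhedge :: "(pt \<Rightarrow> ereal) \<Rightarrow> (nat \<Rightarrow> fn) \<Rightarrow> real \<Rightarrow> fn \<Rightarrow> bool" where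
  "subhedge c \<psi> b a \<longleftrightarrow> \<psi> \<in> Ecal T E \<and> a \<in> A \<and>
     (\<forall>x\<in>Om. ereal ((\<Sum>t\<le>T. \<psi> t x) - b - a x) \<le> c x)"

lemma P_upper:
  assumes "subhedge c \<psi> b a"
  shows "U \<psi> - ereal b \<le> P c"
proof (cases "U \<psi> = -\<infinity>")
  case False
  have \<psi>: "\<psi> \<in> Ecal T E" and a: "a \<in> A"
    and hedge_le: "\<And>x. x \<in> Om \<Longrightarrow> ereal ((\<Sum>t\<le>T. \<psi> t x) - b - a x) \<le> c x"
    using assms by (auto simp: subhedge_def)
  define \<beta> where "\<beta> = (\<lambda>t::nat. if t = 0 then b else 0)"
  define \<phi> where "\<phi> = shift T Om \<psi> (- \<beta>)"
  have sum_\<beta>: "(\<Sum>t\<le>T. \<beta> t) = b" by (simp add: \<beta>_def)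
  have "shift T Om \<phi> \<beta> = \<psi>"
    using \<psi> by (intro ext) (auto simp: \<phi>_def shift_def cst_def Ecal_def)
  then have le_SU: "U \<psi> - ereal b \<le> SU T Om U \<phi>"
    unfolding SU_def by (intro SUP_upper2[of \<beta>]) (auto simp: sum_\<beta>)
  moreover have "-\<infinity> < U \<psi> - ereal b" using False by (cases "U \<psi>") auto
  ultimately have "\<phi> \<in> domSU T Om E U"
    using shift_in_Ecal[OF \<psi>] by (auto simp: domSU_def \<phi>_def)
  moreover have "(\<Sum>t\<le>T. \<phi> t x) = (\<Sum>t\<le>T. \<psi> t x) - b" if "x \<in> Om" for x
    unfolding \<phi>_def sum_shift[OF that] by (simp add: sum_negf sum_\<beta>)
  ultimately have "\<phi> \<in> Phi T Om E U (- a) c"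
    using hedge_le by (simp add: Phi_def)
  then have "SU T Om U \<phi> \<le> P c"
    unfolding Pfrak_def using a by (intro SUP_upper2[of "- a"] SUP_upper) auto
  with le_SU show ?thesis by (rule order_trans)
qed simp

lemma P_least:
  assumes "\<And>\<psi> b a. subhedge c \<psi> b a \<Longrightarrow> U \<psi> - ereal b \<le> y"
  shows "P c \<le> y"
  unfolding Pfrak_def
proof (intro SUP_least)
  fix z \<phi> assume "z \<in> uminus ` A" and \<phi>: "\<phi> \<in> Phi T Om E U z c"
  then obtain a where a: "a \<in> A" "z = - a" by blast
  show "SU T Om U \<phi> \<le> y"
    unfolding SU_def
  proof (rule SUP_least)
    fix \<beta> :: "nat \<Rightarrow> real"
    have "subhedge c (shift T Om \<phi> \<beta>) (\<Sum>t\<le>T. \<beta> t) a"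
      using \<phi> a by (auto simp: subhedge_def Phi_def domSU_def shift_in_Ecal sum_shift)
    then show "U (shift T Om \<phi> \<beta>) - ereal (\<Sum>t\<le>T. \<beta> t) \<le> y" by (rule assms)
  qed
qed

lemma less_P_obtain_subhedge:
  assumes "ereal r < P c"
  obtains \<psi> b a u where "subhedge c \<psi> b a" "U \<psi> = ereal u" "r < u - b"
proof -
  obtain \<psi> b a where sub: "subhedge c \<psi> b a" and r: "ereal r < U \<psi> - ereal b"
    using P_least[of c "ereal r"] assms by (meson not_le)
  have "U \<psi> < \<infinity>" using sub Ufin by (auto simp: subhedge_def)
  with r obtain u where "U \<psi> = ereal u" by (cases "U \<psi>") auto
  with sub r show thesis by (intro that) auto
qed

lemma P_add_le:
  assumes a: "a \<in> A" and shift_le: "\<And>x. x \<in> Om \<Longrightarrow> c x + ereal (k - a x) \<le> c' x"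
  shows "P c + ereal k \<le> P c'"
proof -
  have "P c \<le> P c' - ereal k"
  proof (rule P_least)
    fix \<psi> b a' assume sub: "subhedge c \<psi> b a'"
    have "ereal ((\<Sum>t\<le>T. \<psi> t x) - (b - k) - (a' + a) x) \<le> c' x" if x: "x \<in> Om" for x
    proof -
      have "ereal ((\<Sum>t\<le>T. \<psi> t x) - b - a' x) + ereal (k - a x) \<le> c x + ereal (k - a x)"
        using sub x by (intro add_right_mono) (simp add: subhedge_def)
      also have "\<dots> \<le> c' x" by (rule shift_le[OF x])
      finally show ?thesis by (simp add: algebra_simps)
    qed
    then have "subhedge c' \<psi> (b - k) (a' + a)"
      using sub a A_add by (simp add: subhedge_def)
    from P_upper[OF this] show "U \<psi> - ereal b \<le> P c' - ereal k"
      by (cases "U \<psi>"; cases "P c'") auto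
  qed
  then show ?thesis by (cases "P c"; cases "P c'") auto
qed

lemma P_mono: "(\<And>x. x \<in> Om \<Longrightarrow> c x \<le> c' x) \<Longrightarrow> P c \<le> P c'"
  using P_add_le[OF A0, of c 0 c'] by (simp flip: zero_ereal_def)

lemma P_cash_additive: "P (\<lambda>x. ereal (c x + k)) = P (\<lambda>x. ereal (c x)) + ereal k"
proof (rule antisym)
  have "P (\<lambda>x. ereal (c x + k)) + ereal (- k) \<le> P (\<lambda>x. ereal (c x))"
    by (rule P_add_le[OF A0]) simp
  then show "P (\<lambda>x. ereal (c x + k)) \<le> P (\<lambda>x. ereal (c x)) + ereal k"
    by (cases "P (\<lambda>x. ereal (c x + k))"; cases "P (\<lambda>x. ereal (c x))") auto
  show "P (\<lambda>x. ereal (c x)) + ereal k \<le> P (\<lambda>x. ereal (c x + k))"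
    by (rule P_add_le[OF A0]) simp
qed

lemma subhedge_convex_combination:
  assumes l: "0 < l" "l < 1" and sub: "subhedge c \<psi> b a" "subhedge c' \<psi>' b' a'"
  shows "subhedge (\<lambda>x. ereal l * c x + ereal (1 - l) * c' x)
    (l *\<^sub>R \<psi> + (1 - l) *\<^sub>R \<psi>') (l * b + (1 - l) * b') (l *\<^sub>R a + (1 - l) *\<^sub>R a')"
  unfolding subhedge_def
proof (intro conjI ballI)
  show "l *\<^sub>R \<psi> + (1 - l) *\<^sub>R \<psi>' \<in> Ecal T E"
    using sub by (intro subspace_add subspace_scale subspace_Ecal) (simp_all add: subhedge_def)
  show "l *\<^sub>R a + (1 - l) *\<^sub>R a' \<in> A"
    using sub l by (intro A_convex_combination) (simp_all add: subhedge_def)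
  fix x assume x: "x \<in> Om"
  have "(\<Sum>t\<le>T. (l *\<^sub>R \<psi> + (1 - l) *\<^sub>R \<psi>') t x) = l * (\<Sum>t\<le>T. \<psi> t x) + (1 - l) * (\<Sum>t\<le>T. \<psi>' t x)"
    by (simp add: sum.distrib sum_distrib_left)
  then have "(\<Sum>t\<le>T. (l *\<^sub>R \<psi> + (1 - l) *\<^sub>R \<psi>') t x) - (l * b + (1 - l) * b')
        - (l *\<^sub>R a + (1 - l) *\<^sub>R a') x
      = l * ((\<Sum>t\<le>T. \<psi> t x) - b - a x) + (1 - l) * ((\<Sum>t\<le>T. \<psi>' t x) - b' - a' x)"
    by (simp only:) (simp add: algebra_simps)
  also have "ereal \<dots> = ereal l * ereal ((\<Sum>t\<le>T. \<psi> t x) - b - a x)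
      + ereal (1 - l) * ereal ((\<Sum>t\<le>T. \<psi>' t x) - b' - a' x)"
    by simp
  also have "\<dots> \<le> ereal l * c x + ereal (1 - l) * c' x"
    using sub x l by (intro add_mono ereal_mult_left_mono) (simp_all add: subhedge_def)
  finally show "ereal ((\<Sum>t\<le>T. (l *\<^sub>R \<psi> + (1 - l) *\<^sub>R \<psi>') t x) - (l * b + (1 - l) * b')
      - (l *\<^sub>R a + (1 - l) *\<^sub>R a') x) \<le> ereal l * c x + ereal (1 - l) * c' x" .
qed

lemma P_concave:
  assumes l: "0 < l" "l < 1" and finite: "P c \<noteq> -\<infinity>" "P c' \<noteq> -\<infinity>"
  shows "ereal l * P c + ereal (1 - l) * P c' \<le> P (\<lambda>x. ereal l * c x + ereal (1 - l) * c' x)"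
proof (rule ereal_convex_combination_le_of_less[OF l finite])
  fix r s assume "ereal r < P c" "ereal s < P c'"
  obtain \<psi> b a u where \<psi>: "subhedge c \<psi> b a" "U \<psi> = ereal u" "r < u - b"
    using less_P_obtain_subhedge[OF \<open>ereal r < P c\<close>] .
  obtain \<psi>' b' a' u' where \<psi>': "subhedge c' \<psi>' b' a'" "U \<psi>' = ereal u'" "s < u' - b'"
    using less_P_obtain_subhedge[OF \<open>ereal s < P c'\<close>] .
  have "l * r + (1 - l) * s \<le> l * (u - b) + (1 - l) * (u' - b')"
    using \<psi>(3) \<psi>'(3) l by (intro add_mono mult_left_mono) auto
  also have "\<dots> = (l * u + (1 - l) * u') - (l * b + (1 - l) * b')" by (simp add: algebra_simps)
  finally have "ereal (l * r + (1 - l) * s)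
      \<le> (ereal l * U \<psi> + ereal (1 - l) * U \<psi>') - ereal (l * b + (1 - l) * b')"
    using \<psi>(2) \<psi>'(2) by simp
  also have "\<dots> \<le> U (l *\<^sub>R \<psi> + (1 - l) *\<^sub>R \<psi>') - ereal (l * b + (1 - l) * b')"
    using \<psi>(1) \<psi>'(1) l by (intro ereal_minus_mono U_concave) (simp_all add: subhedge_def)
  also have "\<dots> \<le> P (\<lambda>x. ereal l * c x + ereal (1 - l) * c' x)"
    by (rule P_upper[OF subhedge_convex_combination[OF l \<psi>(1) \<psi>'(1)]])
  finally show "ereal (l * r + (1 - l) * s) \<le> P (\<lambda>x. ereal l * c x + ereal (1 - l) * c' x)" .
qed

lemma Dcal_eq_SUP_V: "Dcal T E U Q = (SUP \<phi>\<in>Ecal T E. ereal (\<Sum>t\<le>T. integral\<^sup>L Q (\<phi> t)) - Vfun U \<phi>)"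
proof -
  have "uminus ` Ecal T E = Ecal T E"
    using subspace_neg[OF subspace_Ecal] by (force simp: image_iff intro: minus_minus[symmetric])
  then have reflect: "(SUP \<phi>\<in>Ecal T E. F \<phi>) = (SUP \<phi>\<in>Ecal T E. F (- \<phi>))"
    for F :: "(nat \<Rightarrow> fn) \<Rightarrow> ereal"
    using SUP_image[of F uminus "Ecal T E"] by (simp add: comp_def)
  have "(SUP \<phi>\<in>Ecal T E. ereal (\<Sum>t\<le>T. integral\<^sup>L Q (\<phi> t)) - Vfun U \<phi>)
      = (SUP \<phi>\<in>Ecal T E. ereal (\<Sum>t\<le>T. integral\<^sup>L Q ((- \<phi>) t)) - Vfun U (- \<phi>))"
    by (rule reflect)
  also have "\<dots> = Dcal T E U Q"
    unfolding Dcal_def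
  proof (rule SUP_cong[OF refl])
    fix \<phi>
    show "ereal (\<Sum>t\<le>T. integral\<^sup>L Q ((- \<phi>) t)) - Vfun U (- \<phi>)
        = U \<phi> - ereal (\<Sum>t\<le>T. integral\<^sup>L Q (\<phi> t))"
      by (cases "U \<phi>") (auto simp: Vfun_def sum_negf fun_Compl_def)
  qed
  finally show ?thesis ..
qed

lemma integral_total:
  assumes "Q \<in> Prob1 d T K" "\<phi> \<in> Ecal T E"
  shows "integral\<^sup>L Q (total \<phi>) = (\<Sum>t\<le>T. integral\<^sup>L Q (\<phi> t))"
  unfolding sum_fun_apply[abs_def]
  using Prob1_integrable[OF assms(1) closed_Om] Ecal_component_in_C[OF assms(2)]
  by (intro Bochner_Integration.integral_sum) auto

lemma Dcal_not_MInf: "Dcal T E U Q \<noteq> -\<infinity>"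
proof -
  have "U (\<lambda>t x. 0) - ereal (\<Sum>t\<le>T. integral\<^sup>L Q (\<lambda>x. 0)) \<le> Dcal T E U Q"
    unfolding Dcal_def using subspace_0[OF subspace_Ecal]
    by (intro SUP_upper2[of "\<lambda>t x. 0"]) (simp_all add: zero_fun_def)
  then show ?thesis using U0 by (cases "U (\<lambda>t x. 0)") auto
qed

lemma integral_subhedge_le_ExpQ:
  assumes Q: "Q \<in> Prob1 d T K \<inter> polarP A" and sub: "subhedge c \<psi> b a"
  shows "ereal ((\<Sum>t\<le>T. integral\<^sup>L Q (\<psi> t)) - b) \<le> ExpQ Q c"
proof -
  have Q_Prob1: "Q \<in> Prob1 d T K" and "integral\<^sup>L Q a \<le> 0" and \<psi>: "\<psi> \<in> Ecal T E" and a: "a \<in> C"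
    using Q sub A_subset_C by (auto simp: subhedge_def polarP_def)
  interpret prob_space Q using Q_Prob1 by (simp add: Prob1_def)
  define h where "h = total \<psi>"
  define s where "s x = h x - b - a x" for x
  have integrable: "integrable Q h" "integrable Q a"
    using total_in_C[OF \<psi>] a by (auto simp: h_def intro: Prob1_integrable[OF Q_Prob1 closed_Om])
  then have integrable_s: "integrable Q s" by (auto simp: s_def[abs_def])
  have "(\<Sum>t\<le>T. integral\<^sup>L Q (\<psi> t)) - b \<le> integral\<^sup>L Q h - b - integral\<^sup>L Q a"
    using integral_total[OF Q_Prob1 \<psi>] \<open>integral\<^sup>L Q a \<le> 0\<close> by (simp add: h_def)
  also have "\<dots> = integral\<^sup>L Q s"
    using integrable by (simp add: s_def[abs_def] prob_space)
  also have "ereal (integral\<^sup>L Q s) = ExpQ Q (\<lambda>x. ereal (s x))"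
    by (rule ExpQ_ereal[OF integrable_s, symmetric])
  also have "\<dots> \<le> ExpQ Q c"
  proof (rule ExpQ_mono_AE)
    show "AE x in Q. ereal (s x) \<le> c x"
      using Prob1_AE_Omega[OF Q_Prob1 closed_Om]
      by eventually_elim (use sub in \<open>auto simp: subhedge_def s_def h_def\<close>)
  qed
  finally show ?thesis by simp
qed

theorem weak_duality:
  assumes Q: "Q \<in> Prob1 d T K \<inter> polarP A"
  shows "P c \<le> ExpQ Q c + Dcal T E U Q"
proof (rule P_least)
  fix \<psi> b a assume sub: "subhedge c \<psi> b a"
  have "U \<psi> - ereal (\<Sum>t\<le>T. integral\<^sup>L Q (\<psi> t)) \<le> Dcal T E U Q"
    unfolding Dcal_def using sub by (intro SUP_upper) (simp add: subhedge_def)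
  then show "U \<psi> - ereal b \<le> ExpQ Q c + Dcal T E U Q"
    using integral_subhedge_le_ExpQ[OF Q sub] Dcal_not_MInf[of Q]
    by (cases "U \<psi>"; cases "ExpQ Q c"; cases "Dcal T E U Q") auto
qed

end

locale tight_subhedging = subhedging d T K E U A
  for d T :: nat
    and K :: "nat \<Rightarrow> nat \<Rightarrow> real set"
    and E :: "nat \<Rightarrow> fn set"
    and U :: "(nat \<Rightarrow> fn) \<Rightarrow> ereal"
    and A :: "fn set" +
  fixes KK :: "nat \<Rightarrow> nat \<Rightarrow> (nat \<Rightarrow> real) set"
    and f :: "nat \<Rightarrow> nat \<Rightarrow> fn"
  assumes KKcompact: "\<forall>t\<le>T. \<forall>n\<ge>1. compact (KK t n)"
    and fE: "\<forall>t\<le>T. \<forall>n\<ge>1. f t n \<in> E t"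
    and fnonneg: "\<forall>t\<le>T. \<forall>n\<ge>1. \<forall>x\<in>Omega d T K. 0 \<le> f t n x"
    and fdom: "\<forall>n\<ge>1. \<forall>x\<in>Omega d T K. \<not> (\<forall>t\<le>T. (\<lambda>j. x (t,j)) \<in> KK t n) \<longrightarrow>
                  1 + absum d T x \<le> (\<Sum>t\<le>T. f t n x)"
    and fV: "\<forall>\<Gamma>>0. (\<lambda>n. Vfun U (\<lambda>t. if t \<le> T then (\<lambda>x. \<Gamma> * f t n x) else (\<lambda>x. 0)))
                  \<longlonglongrightarrow> 0"
begin

definition tail :: "nat \<Rightarrow> nat \<Rightarrow> fn" where
  "tail n = (\<lambda>t. if t \<le> T then f t n else 0)"

lemma tail_in_Ecal: "1 \<le> n \<Longrightarrow> tail n \<in> Ecal T E"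
  using fE by (auto simp: tail_def Ecal_def zero_fun_def)

lemma tail_nonneg:
  assumes "1 \<le> n"
  shows "0 \<le> total (tail n)"
proof (rule le_funI)
  fix x
  show "0 x \<le> total (tail n) x"
  proof (cases "x \<in> Om")
    case True
    then show ?thesis using fnonneg assms by (auto simp: tail_def intro: sum_nonneg)
  next
    case False
    then show ?thesis
      using total_in_C[OF tail_in_Ecal[OF assms]] by (simp add: weighted_continuous_def)
  qed
qed

lemma tail_dominates_weight:
  assumes n: "1 \<le> n"
  obtains R where "\<And>x. x \<in> Om \<Longrightarrow> R < w x \<Longrightarrow> w x \<le> total (tail n) x"
proof -
  have "\<exists>B. \<forall>y\<in>KK t n. \<bar>y j\<bar> \<le> B" if "t \<le> T" for t j
  proof -
    have "compact ((\<lambda>y. y j) ` KK t n)"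
      using KKcompact that n
      by (intro compact_continuous_image
          continuous_on_subset[OF continuous_on_product_coordinates]) auto
    then show ?thesis using compact_imp_bounded by (force simp: bounded_real)
  qed
  then obtain B where B: "\<And>t j y. t \<le> T \<Longrightarrow> y \<in> KK t n \<Longrightarrow> \<bar>y j\<bar> \<le> B t j" by metis
  define R where "R = 1 + (\<Sum>s\<le>T. \<Sum>j=1..d. B s j)"
  have "w x \<le> R" if "\<forall>t\<le>T. (\<lambda>j. x (t, j)) \<in> KK t n" for x
    unfolding R_def path_weight_def absum_def using B[of _ "\<lambda>j. x (_, j)"] that
    by (intro add_left_mono sum_mono) auto
  then show thesis
    using fdom n by (intro that[of R]) (force simp: path_weight_def tail_def)
qed

lemma obtain_U_neg_tail_gt:
  assumes "0 < \<Gamma>"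
  obtains n where "1 \<le> n" "ereal (-1) < U (- (\<Gamma> *\<^sub>R tail n))"
proof -
  have "(\<lambda>t. if t \<le> T then (\<lambda>x. \<Gamma> * f t n x) else (\<lambda>x. 0)) = \<Gamma> *\<^sub>R tail n" for n
    by (auto simp: fun_eq_iff tail_def)
  then have "(\<lambda>n. - U (- (\<Gamma> *\<^sub>R tail n))) \<longlonglongrightarrow> 0"
    using fV[rule_format, OF assms] by (simp add: Vfun_def fun_Compl_def)
  from order_tendstoD(2)[OF this, of 1]
  have "\<forall>\<^sub>F n in sequentially. ereal (-1) < U (- (\<Gamma> *\<^sub>R tail n))"
    by (simp add: ereal_uminus_less_reorder one_ereal_def)
  then have "\<forall>\<^sub>F n in sequentially. 1 \<le> n \<and> ereal (-1) < U (- (\<Gamma> *\<^sub>R tail n))"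
    using eventually_ge_at_top[of 1] by eventually_elim auto
  then show thesis using that by (auto simp: eventually_sequentially)
qed

lemma P_not_MInf:
  assumes "weighted_bounded_below Om w c"
  shows "P c \<noteq> -\<infinity>"
proof -
  obtain M where M: "\<And>x. x \<in> Om \<Longrightarrow> ereal (- M * w x) \<le> c x"
    using assms by (auto simp: weighted_bounded_below_def)
  define \<Gamma> where "\<Gamma> = max M 1"
  have \<Gamma>: "0 < \<Gamma>" "M \<le> \<Gamma>" by (auto simp: \<Gamma>_def)
  obtain n where n: "1 \<le> n" "ereal (-1) < U (- (\<Gamma> *\<^sub>R tail n))"
    using obtain_U_neg_tail_gt[OF \<Gamma>(1)] .
  obtain R where R: "\<And>x. x \<in> Om \<Longrightarrow> R < w x \<Longrightarrow> w x \<le> total (tail n) x"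
    using tail_dominates_weight[OF n(1)] by blast
  have "subhedge c (- (\<Gamma> *\<^sub>R tail n)) (\<Gamma> * \<bar>R\<bar>) 0"
    unfolding subhedge_def
  proof (intro conjI ballI)
    fix x assume x: "x \<in> Om"
    have "0 \<le> total (tail n) x" using tail_nonneg[OF n(1)] by (simp only: le_fun_def zero_fun_apply)
    then have "w x \<le> total (tail n) x + \<bar>R\<bar>" using R[OF x] by (cases "R < w x") auto
    then have "\<Gamma> * w x \<le> \<Gamma> * (total (tail n) x + \<bar>R\<bar>)" using \<Gamma>(1) by (intro mult_left_mono) auto
    moreover have "M * w x \<le> \<Gamma> * w x"
      using \<Gamma> weight_ge_1[OF x] by (intro mult_right_mono) auto
    ultimately have "(\<Sum>t\<le>T. (- (\<Gamma> *\<^sub>R tail n)) t x) - \<Gamma> * \<bar>R\<bar> - 0 x \<le> - M * w x"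
      by (simp add: sum_negf sum_distrib_left[symmetric] algebra_simps)
    then show "ereal ((\<Sum>t\<le>T. (- (\<Gamma> *\<^sub>R tail n)) t x) - \<Gamma> * \<bar>R\<bar> - 0 x) \<le> c x"
      using M[OF x] by (meson ereal_less_eq(3) order_trans)
  qed (use A0 tail_in_Ecal[OF n(1)] in \<open>auto simp: zero_fun_def intro: subspace_neg[OF subspace_Ecal]
        subspace_scale[OF subspace_Ecal]\<close>)
  from P_upper[OF this] n(2) show ?thesis by (cases "U (- (\<Gamma> *\<^sub>R tail n))") auto
qed

abbreviation W :: "fn set" where "W \<equiv> weighted_bounded Om w"

lemmas W_closed = subspace_0[OF subspace_weighted_bounded]
  subspace_add[OF subspace_weighted_bounded] subspace_diff[OF subspace_weighted_bounded]
  subspace_scale[OF subspace_weighted_bounded] subspace_neg[OF subspace_weighted_bounded]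

text \<open>Finiteness propagates because \<open>c\<close> is the midpoint of \<open>c + g\<close> and \<open>c - g\<close>.\<close>

lemma P_add_finite:
  assumes below: "weighted_bounded_below Om w c" and fin: "P c < \<infinity>" and g: "g \<in> W"
  shows "\<bar>P (\<lambda>x. c x + ereal (g x))\<bar> \<noteq> \<infinity>"
proof -
  let ?plus = "P (\<lambda>x. c x + ereal (g x))" and ?minus = "P (\<lambda>x. c x + ereal ((- g) x))"
  have not_MInf: "?plus \<noteq> -\<infinity>" "?minus \<noteq> -\<infinity>"
    by (intro P_not_MInf weighted_bounded_below_add below W_closed g)+
  have "ereal (1/2) * ?plus + ereal (1 - 1/2) * ?minus
      \<le> P (\<lambda>x. ereal (1/2) * (c x + ereal (g x)) + ereal (1 - 1/2) * (c x + ereal ((- g) x)))"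
    by (rule P_concave) (use not_MInf in auto)
  also have "\<dots> \<le> P c"
  proof (rule P_mono)
    fix x assume "x \<in> Om"
    show "ereal (1/2) * (c x + ereal (g x)) + ereal (1 - 1/2) * (c x + ereal ((- g) x)) \<le> c x"
      by (cases "c x") (auto simp: field_simps)
  qed
  finally have "?plus \<noteq> \<infinity>" using fin not_MInf(2) by (cases ?minus) auto
  with not_MInf(1) show ?thesis by auto
qed

definition perturbed_value :: "(pt \<Rightarrow> ereal) \<Rightarrow> fn \<Rightarrow> real" where
  "perturbed_value c g = real_of_ereal (P (\<lambda>x. c x + ereal (g x)))"

lemma ereal_perturbed_value:
  assumes "weighted_bounded_below Om w c" "P c < \<infinity>" "g \<in> W"
  shows "ereal (perturbed_value c g) = P (\<lambda>x. c x + ereal (g x))"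
  unfolding perturbed_value_def by (rule ereal_real') (rule P_add_finite[OF assms])

lemma concave_on_perturbed_value:
  assumes below: "weighted_bounded_below Om w c" and fin: "P c < \<infinity>"
  shows "concave_on W (perturbed_value c)"
  unfolding concave_on_def
proof
  fix l :: real and g h assume l: "0 < l" "l < 1" and gh: "g \<in> W" "h \<in> W"
  note perturbed = ereal_perturbed_value[OF below fin]
  have "ereal (1 - l) * ereal (perturbed_value c g)
        + ereal (1 - (1 - l)) * ereal (perturbed_value c h)
      \<le> P (\<lambda>x. ereal (1 - l) * (c x + ereal (g x)) + ereal (1 - (1 - l)) * (c x + ereal (h x)))"
    unfolding perturbed[OF gh(1)] perturbed[OF gh(2)]
    using l by (intro P_concave P_not_MInf weighted_bounded_below_add below gh) auto
  also have "\<dots> \<le> P (\<lambda>x. c x + ereal (((1 - l) *\<^sub>R g + l *\<^sub>R h) x))"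
  proof (rule P_mono)
    fix x
    show "ereal (1 - l) * (c x + ereal (g x)) + ereal (1 - (1 - l)) * (c x + ereal (h x))
        \<le> c x + ereal (((1 - l) *\<^sub>R g + l *\<^sub>R h) x)"
      using l by (cases "c x") (auto simp: algebra_simps)
  qed
  also have "\<dots> = ereal (perturbed_value c ((1 - l) *\<^sub>R g + l *\<^sub>R h))"
    by (intro perturbed[symmetric] W_closed gh)
  finally show "- perturbed_value c ((1 - l) *\<^sub>R g + l *\<^sub>R h)
      \<le> (1 - l) * - perturbed_value c g + l * - perturbed_value c h"
    by simp
qed (rule subspace_imp_convex[OF subspace_weighted_bounded])

lemma perturbed_value_mono:
  assumes "weighted_bounded_below Om w c" "P c < \<infinity>" "g \<in> W" "h \<in> W"
    and pointwise_le: "\<And>x. x \<in> Om \<Longrightarrow> g x \<le> h x"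
  shows "perturbed_value c g \<le> perturbed_value c h"
proof -
  have "ereal (perturbed_value c g) \<le> ereal (perturbed_value c h)"
    unfolding ereal_perturbed_value[OF assms(1-3)] ereal_perturbed_value[OF assms(1,2,4)]
    using pointwise_le by (intro P_mono add_left_mono) simp
  then show ?thesis by simp
qed

lemma P_ereal_finite:
  assumes "\<exists>h\<in>Bspace d T K. P (\<lambda>x. ereal (h x)) < \<infinity>" and g: "g \<in> W"
  shows "P (\<lambda>x. ereal (g x)) \<noteq> \<infinity>" "P (\<lambda>x. ereal (g x)) \<noteq> -\<infinity>"
proof -
  obtain h where h: "h \<in> W" "P (\<lambda>x. ereal (h x)) < \<infinity>"
    using assms(1) Bspace_subset_weighted_bounded by blast
  have "\<bar>P (\<lambda>x. ereal (h x) + ereal ((g - h) x))\<bar> \<noteq> \<infinity>"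
    by (intro P_add_finite weighted_bounded_below_ereal W_closed g h)
  then show "P (\<lambda>x. ereal (g x)) \<noteq> \<infinity>" "P (\<lambda>x. ereal (g x)) \<noteq> -\<infinity>" by auto
qed

lemma P_ereal_concave:
  assumes "c \<in> W" "c' \<in> W" and l: "l \<in> {0..1}"
  shows "ereal l * P (\<lambda>x. ereal (c x)) + ereal (1 - l) * P (\<lambda>x. ereal (c' x))
    \<le> P (\<lambda>x. ereal (l * c x + (1 - l) * c' x))"
proof -
  consider (right) "l = 0" | (left) "l = 1" | (interior) "0 < l" "l < 1" using l by force
  then show ?thesis
  proof cases
    case interior
    have "P (\<lambda>x. ereal (c x)) \<noteq> -\<infinity>" "P (\<lambda>x. ereal (c' x)) \<noteq> -\<infinity>"
      using assms(1,2) by (auto intro!: P_not_MInf weighted_bounded_below_ereal)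
    from P_concave[OF interior this] show ?thesis by simp
  qed (simp_all flip: zero_ereal_def one_ereal_def)
qed

lemma P_norm_continuous:
  assumes ex: "\<exists>h\<in>Bspace d T K. P (\<lambda>x. ereal (h x)) < \<infinity>"
    and c: "c \<in> Bspace d T K" and e: "0 < e"
  shows "\<exists>\<delta>>0. \<forall>c'\<in>Bspace d T K. normB d T K (\<lambda>x. c' x - c x) < ereal \<delta> \<longrightarrow>
    \<bar>real_of_ereal (P (\<lambda>x. ereal (c' x))) - real_of_ereal (P (\<lambda>x. ereal (c x)))\<bar> < e"
proof -
  have below: "weighted_bounded_below Om w (\<lambda>x. 0)" and fin: "P (\<lambda>x. 0) < \<infinity>"
    using weighted_bounded_below_ereal[OF W_closed(1)] P_ereal_finite(1)[OF ex W_closed(1)]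
    by (simp_all flip: zero_ereal_def)
  define p where "p = perturbed_value (\<lambda>x. 0)"
  have p_eq: "p g = real_of_ereal (P (\<lambda>x. ereal (g x)))" for g
    by (simp add: p_def perturbed_value_def)
  define D where "D = p c - p (c - w)"
  define \<delta> where "\<delta> = min 1 (e / (\<bar>D\<bar> + 1))"
  have \<delta>: "0 < \<delta>" "\<delta> \<le> 1" using e by (auto simp: \<delta>_def intro!: divide_pos_pos add_nonneg_pos)
  have "\<delta> * D \<le> \<delta> * \<bar>D\<bar>" using \<delta>(1) by (intro mult_left_mono) auto
  also have "\<dots> < \<delta> * (\<bar>D\<bar> + 1)" using \<delta>(1) by simp
  also have "\<dots> \<le> e / (\<bar>D\<bar> + 1) * (\<bar>D\<bar> + 1)" by (intro mult_right_mono) (auto simp: \<delta>_def)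
  also have "\<dots> = e" by simp
  finally have small: "\<delta> * D < e" .
  have "\<bar>p c' - p c\<bar> < e"
    if c': "c' \<in> Bspace d T K" and near: "normB d T K (\<lambda>x. c' x - c x) < ereal \<delta>" for c'
  proof -
    have "\<bar>p c' - p c\<bar> \<le> \<delta> * D"
      unfolding D_def
    proof (rule concave_mono_dist_le[OF subspace_weighted_bounded])
      show "concave_on W p" unfolding p_def by (rule concave_on_perturbed_value[OF below fin])
      show "p f \<le> p g" if "f \<in> W" "g \<in> W" "\<And>x. x \<in> Om \<Longrightarrow> f x \<le> g x" for f g
        unfolding p_def using that by (rule perturbed_value_mono[OF below fin])
      show "\<bar>c' x - c x\<bar> \<le> \<delta> * w x" if "x \<in> Om" for x
        by (rule normB_less_imp_le[OF near that])
    qed (use c c' \<delta> Bspace_subset_weighted_bounded weight_weighted_bounded in auto)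
    with small show ?thesis by simp
  qed
  then show ?thesis using \<delta>(1) unfolding p_eq by blast
qed

lemma supergradient_exists:
  assumes below: "weighted_bounded_below Om w c" and fin: "P c < \<infinity>"
  obtains L p where "linear L" "P c = ereal p"
    "\<And>g. g \<in> C \<Longrightarrow> P (\<lambda>x. c x + ereal (g x)) \<le> ereal (p + L g)"
proof -
  note perturbed = ereal_perturbed_value[OF below fin]
  define p where "p = perturbed_value c 0"
  have convex: "convex_on C (\<lambda>g. p + - perturbed_value c g)"
  proof (rule convex_on_add)
    show "convex_on C (\<lambda>g. p)"
      using subspace_imp_convex[OF subspace_weighted_continuous] by (simp add: convex_on_const)
    show "convex_on C (\<lambda>g. - perturbed_value c g)"
      using concave_on_perturbed_value[OF below fin] weighted_continuous_subset
        subspace_imp_convex[OF subspace_weighted_continuous]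
      unfolding concave_on_def by (rule convex_on_subset)
  qed
  have "0 \<le> p + - perturbed_value c 0" by (simp add: p_def)
  with convex obtain L where L: "linear L" "\<And>g. g \<in> C \<Longrightarrow> L g \<le> p + - perturbed_value c g"
    using Hahn_Banach_convex_majorant[OF subspace_weighted_continuous] by blast
  show thesis
  proof (rule that[of "\<lambda>g. - L g" p])
    show "linear (\<lambda>g. - L g)" using L(1) by (rule linear_compose_neg)
    show "P c = ereal p"
      using perturbed[OF W_closed(1)] by (simp add: p_def flip: zero_ereal_def)
    show "P (\<lambda>x. c x + ereal (g x)) \<le> ereal (p + - L g)" if g: "g \<in> C" for g
    proof -
      have "g \<in> W" using g weighted_continuous_subset by blast
      then have "P (\<lambda>x. c x + ereal (g x)) = ereal (perturbed_value c g)"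
        by (rule perturbed[symmetric])
      with L(2)[OF g] show ?thesis by simp
    qed
  qed
qed

end

locale subhedging_supergradient = tight_subhedging d T K E U A KK f
  for d T :: nat
    and K :: "nat \<Rightarrow> nat \<Rightarrow> real set"
    and E :: "nat \<Rightarrow> fn set"
    and U :: "(nat \<Rightarrow> fn) \<Rightarrow> ereal"
    and A :: "fn set"
    and KK :: "nat \<Rightarrow> nat \<Rightarrow> (nat \<Rightarrow> real) set"
    and f :: "nat \<Rightarrow> nat \<Rightarrow> fn" +
  fixes c :: "pt \<Rightarrow> ereal" and p :: real and L :: "fn \<Rightarrow> real"
  assumes lsc: "lower_semicontinuous_on Om c"
    and below: "weighted_bounded_below Om w c"
    and P_c: "P c = ereal p"
    and linear_L: "linear L"
    and supergradient: "\<And>g. g \<in> C \<Longrightarrow> P (\<lambda>x. c x + ereal (g x)) \<le> ereal (p + L g)"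
begin

lemma le_supergradient:
  assumes a: "a \<in> A" and g: "g \<in> C" and bound: "\<And>x. x \<in> Om \<Longrightarrow> k - a x \<le> g x"
  shows "k \<le> L g"
proof -
  have "P c + ereal k \<le> P (\<lambda>x. c x + ereal (g x))"
    using bound by (intro P_add_le[OF a] add_left_mono) simp
  also have "\<dots> \<le> ereal (p + L g)" by (rule supergradient[OF g])
  finally show ?thesis by (simp add: P_c)
qed

lemma L_nonneg: "g \<in> C \<Longrightarrow> 0 \<le> g \<Longrightarrow> 0 \<le> L g"
  by (rule le_supergradient[OF A0]) (simp_all add: le_fun_def)

lemma L_indicator: "L (indicator Om) = 1"
proof (rule antisym)
  have "-1 \<le> L (- indicator Om)"
    by (rule le_supergradient[OF A0]) (simp_all add: C_closed indicator_in_C)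
  then show "L (indicator Om) \<le> 1" by (simp add: linear_neg[OF linear_L])
  show "1 \<le> L (indicator Om)" by (rule le_supergradient[OF A0 indicator_in_C]) simp
qed

lemma L_nonpos_on_A:
  assumes "a \<in> A"
  shows "L a \<le> 0"
proof -
  have "0 \<le> L (- a)"
    using assms A_subset_C by (intro le_supergradient[OF assms] C_closed) auto
  then show ?thesis by (simp add: linear_neg[OF linear_L])
qed

lemma U_le_supergradient:
  assumes \<phi>: "\<phi> \<in> Ecal T E" and h: "h \<in> C" "\<And>x. x \<in> Om \<Longrightarrow> ereal (h x) \<le> c x"
  shows "U \<phi> \<le> ereal (p + L (total \<phi>) - L h)"
proof -
  have "subhedge (\<lambda>x. c x + ereal ((total \<phi> - h) x)) \<phi> 0 0"
    unfolding subhedge_def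
  proof (intro conjI ballI)
    fix x assume "x \<in> Om"
    then show "ereal ((\<Sum>t\<le>T. \<phi> t x) - 0 - 0 x) \<le> c x + ereal ((total \<phi> - h) x)"
      using h(2)[of x] by (cases "c x") auto
  qed (use \<phi> A0 in \<open>auto simp: zero_fun_def\<close>)
  from P_upper[OF this] have "U \<phi> \<le> P (\<lambda>x. c x + ereal ((total \<phi> - h) x))"
    by (simp flip: zero_ereal_def)
  also have "\<dots> \<le> ereal (p + L (total \<phi> - h))"
    by (intro supergradient C_closed total_in_C \<phi> h)
  finally show ?thesis by (simp add: linear_diff[OF linear_L] add_diff_eq)
qed

lemma C_minorant:
  obtains h where "h \<in> C" "\<And>x. x \<in> Om \<Longrightarrow> ereal (h x) \<le> c x"
proof -
  obtain M where M: "\<And>x. x \<in> Om \<Longrightarrow> ereal (- M * w x) \<le> c x"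
    using below by (auto simp: weighted_bounded_below_def)
  show thesis
  proof
    show "(- M) *\<^sub>R (\<lambda>x. indicator Om x * w x) \<in> C" by (intro C_closed weight_in_C)
  qed (use M in simp)
qed

lemma tight:
  assumes e: "0 < e"
  shows "\<exists>F\<in>C. \<exists>R. 0 \<le> F \<and> (\<forall>x\<in>Om. R < w x \<longrightarrow> w x \<le> F x) \<and> L F \<le> e"
proof -
  obtain h where h: "h \<in> C" "\<And>x. x \<in> Om \<Longrightarrow> ereal (h x) \<le> c x"
    using C_minorant by blast
  define \<Gamma> where "\<Gamma> = (\<bar>p - L h\<bar> + 1) / e"
  have \<Gamma>: "0 < \<Gamma>" using e by (simp add: \<Gamma>_def add_pos_nonneg zero_less_divide_iff)
  obtain n where n: "1 \<le> n" "ereal (-1) < U (- (\<Gamma> *\<^sub>R tail n))"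
    using obtain_U_neg_tail_gt[OF \<Gamma>] .
  have neg_tail_in_Ecal: "- (\<Gamma> *\<^sub>R tail n) \<in> Ecal T E"
    by (intro subspace_neg subspace_scale subspace_Ecal tail_in_Ecal n)
  have "total (- (\<Gamma> *\<^sub>R tail n)) = (- \<Gamma>) *\<^sub>R total (tail n)"
    by (simp add: sum_negf scaleR_sum_right)
  then have "L (total (- (\<Gamma> *\<^sub>R tail n))) = - \<Gamma> * L (total (tail n))"
    by (simp only: linear_scale[OF linear_L] real_scaleR_def)
  with less_le_trans[OF n(2) U_le_supergradient[OF neg_tail_in_Ecal h]]
  have "-1 < p - \<Gamma> * L (total (tail n)) - L h"
    by (simp only: ereal_less_eq ereal_less) simp
  then have "\<Gamma> * L (total (tail n)) \<le> \<Gamma> * e" using e by (simp add: \<Gamma>_def)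
  then have "L (total (tail n)) \<le> e" using \<Gamma> by simp
  moreover obtain R where "\<And>x. x \<in> Om \<Longrightarrow> R < w x \<Longrightarrow> w x \<le> total (tail n) x"
    using tail_dominates_weight[OF n(1)] by blast
  ultimately show ?thesis
    using total_in_C[OF tail_in_Ecal[OF n(1)]] tail_nonneg[OF n(1)] by blast
qed

sublocale tight_functional Om w L
  by (rule tight_functional.intro[OF weighted_space_axioms])
    (rule tight_functional_axioms.intro; fact linear_L L_nonneg L_indicator tight)

lemma representing_measure_integral:
  assumes "g \<in> C"
  shows "integrable representing_measure g" "integral\<^sup>L representing_measure g = L g"
  using has_bochner_integral_representing_measure[OF assms]
  by (simp_all add: has_bochner_integral_iff)

lemma representing_measure_in_Prob1: "representing_measure \<in> Prob1 d T K"
  by (intro Prob1I prob_space_representing_measure sets_representing_measure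
      emeasure_representing_measure_S closed_Om representing_measure_integral weight_in_C)

lemma representing_measure_in_polarP: "representing_measure \<in> polarP A"
  using L_nonpos_on_A A_subset_C by (auto simp: polarP_def representing_measure_integral)

lemma AE_representing_measure: "AE x in representing_measure. x \<in> Om"
  by (rule Prob1_AE_Omega[OF representing_measure_in_Prob1 closed_Om])

lemma C_approximation:
  obtains h where "\<And>n. h n \<in> C" "\<And>n x. x \<in> Om \<Longrightarrow> ereal (h n x) \<le> c x"
    "(\<lambda>n. ereal (L (h n))) \<longlonglongrightarrow> ExpQ representing_measure c"
proof -
  have "Om \<noteq> {}" using emeasure_representing_measure_S by auto
  then obtain h where h: "\<And>n. h n \<in> C" "incseq h" "\<And>x. x \<in> Om \<Longrightarrow> (SUP n. ereal (h n x)) = c x"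
    using lower_semicontinuous_approximation[OF lsc below] by blast
  have "ereal (h n x) \<le> c x" if "x \<in> Om" for n x
    unfolding h(3)[OF that, symmetric] by (rule SUP_upper) simp
  moreover have "(\<lambda>n. ereal (integral\<^sup>L representing_measure (h n))) \<longlonglongrightarrow> ExpQ representing_measure c"
    using AE_representing_measure h
    by (intro ExpQ_monotone_convergence representing_measure_integral) (auto elim: eventually_mono)
  ultimately show thesis
    by (intro that[of h] h(1)) (simp_all add: representing_measure_integral(2)[OF h(1)])
qed

lemma ExpQ_le:
  assumes "\<phi> \<in> Ecal T E" "U \<phi> = ereal u"
  shows "ExpQ representing_measure c \<le> ereal (p + L (total \<phi>) - u)"
proof -
  obtain h where h: "\<And>n. h n \<in> C" "\<And>n x. x \<in> Om \<Longrightarrow> ereal (h n x) \<le> c x"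
    and lim: "(\<lambda>n. ereal (L (h n))) \<longlonglongrightarrow> ExpQ representing_measure c"
    using C_approximation by blast
  show ?thesis
    using U_le_supergradient[OF assms(1) h] assms(2)
    by (intro LIMSEQ_le_const2[OF lim]) (auto simp: algebra_simps)
qed

lemma ExpQ_finite: "\<bar>ExpQ representing_measure c\<bar> \<noteq> \<infinity>"
proof -
  have zero: "0 \<in> Ecal T E" using subspace_0[OF subspace_Ecal] .
  then obtain u where "U 0 = ereal u"
    using U0 Ufin by (cases "U 0") (auto simp: zero_fun_def)
  with ExpQ_le[OF zero] have "ExpQ representing_measure c \<noteq> \<infinity>" by force
  moreover obtain h where h: "h \<in> C" "\<And>x. x \<in> Om \<Longrightarrow> ereal (h x) \<le> c x"
    using C_minorant by blast
  have "ExpQ representing_measure (\<lambda>x. ereal (h x)) \<le> ExpQ representing_measure c"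
    using AE_representing_measure h(2) by (intro ExpQ_mono_AE) (auto elim: eventually_mono)
  then have "ExpQ representing_measure c \<noteq> -\<infinity>"
    by (auto simp: ExpQ_ereal[OF representing_measure_integral(1)[OF h(1)]])
  ultimately show ?thesis by auto
qed

theorem ExpQ_plus_Dcal_le: "ExpQ representing_measure c + Dcal T E U representing_measure \<le> P c"
proof -
  let ?Q = representing_measure
  obtain e where e: "ExpQ ?Q c = ereal e" using ExpQ_finite by (cases "ExpQ ?Q c") auto
  have "Dcal T E U ?Q \<le> ereal (p - e)"
    unfolding Dcal_def
  proof (rule SUP_least)
    fix \<phi> assume \<phi>: "\<phi> \<in> Ecal T E"
    have "(\<Sum>t\<le>T. integral\<^sup>L ?Q (\<phi> t)) = L (total \<phi>)"
      using integral_total[OF representing_measure_in_Prob1 \<phi>]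
        representing_measure_integral[OF total_in_C[OF \<phi>]]
      by simp
    then show "U \<phi> - ereal (\<Sum>t\<le>T. integral\<^sup>L ?Q (\<phi> t)) \<le> ereal (p - e)"
      using ExpQ_le[OF \<phi>] Ufin \<phi> e by (cases "U \<phi>") (auto simp: algebra_simps)
  qed
  then show ?thesis
    unfolding e P_c by (cases "Dcal T E U ?Q") auto
qed

end

context tight_subhedging
begin

theorem duality:
  assumes lsc: "lsc_on Om c" and below: "weighted_bounded_below Om w c"
  shows duality_attained: "P c < \<infinity> \<Longrightarrow> \<exists>Q\<in>Prob1 d T K \<inter> polarP A. P c = ExpQ Q c + Dcal T E U Q"
    and duality_INF: "P c = (INF Q\<in>Prob1 d T K \<inter> polarP A. ExpQ Q c + Dcal T E U Q)"
proof -
  show attained: "\<exists>Q\<in>Prob1 d T K \<inter> polarP A. P c = ExpQ Q c + Dcal T E U Q" if fin: "P c < \<infinity>"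
  proof -
    have lower_semicontinuous: "lower_semicontinuous_on Om c"
      using lsc by (simp add: lsc_on_def lower_semicontinuous_on_def)
    obtain L p where L: "linear L" "P c = ereal p"
      "\<And>g. g \<in> C \<Longrightarrow> P (\<lambda>x. c x + ereal (g x)) \<le> ereal (p + L g)"
      using supergradient_exists[OF below fin] by blast
    interpret subhedging_supergradient d T K E U A KK f c p L
      by (rule subhedging_supergradient.intro[OF tight_subhedging_axioms
            subhedging_supergradient_axioms.intro[OF lower_semicontinuous below L(2,1,3)]])
    have "representing_measure \<in> Prob1 d T K \<inter> polarP A"
      using representing_measure_in_Prob1 representing_measure_in_polarP by blast
    then show ?thesis
      using weak_duality ExpQ_plus_Dcal_le by (meson antisym)
  qed
  show "P c = (INF Q\<in>Prob1 d T K \<inter> polarP A. ExpQ Q c + Dcal T E U Q)"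
  proof (rule antisym)
    show "P c \<le> (INF Q\<in>Prob1 d T K \<inter> polarP A. ExpQ Q c + Dcal T E U Q)"
      by (rule INF_greatest) (rule weak_duality)
    show "(INF Q\<in>Prob1 d T K \<inter> polarP A. ExpQ Q c + Dcal T E U Q) \<le> P c"
    proof (cases "P c < \<infinity>")
      case True
      then obtain Q where "Q \<in> Prob1 d T K \<inter> polarP A" "P c = ExpQ Q c + Dcal T E U Q"
        using attained by blast
      then show ?thesis by (intro INF_lower2[of Q]) simp_all
    qed simp
  qed
qed

end

theorem theorem2p11:
  fixes d T :: nat
    and K :: "nat \<Rightarrow> nat \<Rightarrow> real set"
    and E :: "nat \<Rightarrow> fn set"
    and U :: "(nat \<Rightarrow> fn) \<Rightarrow> ereal"
    and A :: "fn set"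
    and KK :: "nat \<Rightarrow> nat \<Rightarrow> (nat \<Rightarrow> real) set"
    and f :: "nat \<Rightarrow> nat \<Rightarrow> fn"
  defines "Om \<equiv> Omega d T K"
  assumes d1: "1 \<le> d" and T1: "1 \<le> T"
    and Kclosed: "\<forall>t\<le>T. \<forall>j\<in>{1..d}. closed (K t j)"
    \<comment> \<open>E_t vector subspaces with R \<subseteq> E_t \<subseteq> C_{0:t}\<close>
    and Esub: "\<forall>t\<le>T. E t \<subseteq> Cspace d T K t"
    and Eadd: "\<forall>t\<le>T. \<forall>\<phi>\<in>E t. \<forall>\<psi>\<in>E t. (\<lambda>x. \<phi> x + \<psi> x) \<in> E t"
    and Esmult: "\<forall>t\<le>T. \<forall>\<phi>\<in>E t. \<forall>r::real. (\<lambda>x. r * \<phi> x) \<in> E t"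
    and Econst: "\<forall>t\<le>T. \<forall>k::real. cst Om k \<in> E t"
    \<comment> \<open>U : \<E> \<rightarrow> [-\<infinity>,+\<infinity>), concave, U(0) real\<close>
    and Ufin: "\<forall>\<phi>\<in>Ecal T E. U \<phi> < \<infinity>"
    and Uconc: "\<forall>\<phi>\<in>Ecal T E. \<forall>\<psi>\<in>Ecal T E. \<forall>l\<in>{0<..<(1::real)}.
                  ereal l * U \<phi> + ereal (1 - l) * U \<psi>
                  \<le> U (\<lambda>t x. l * \<phi> t x + (1 - l) * \<psi> t x)"
    and U0: "U (\<lambda>t x. 0) \<noteq> -\<infinity>"
    \<comment> \<open>\<A> \<subseteq> C_{0:T} convex cone containing 0\<close>
    and Asub: "A \<subseteq> Cspace d T K T"
    and A0: "(\<lambda>x. 0) \<in> A"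
    and Acone: "\<forall>a\<in>A. \<forall>b\<in>A. \<forall>r\<ge>0. \<forall>s\<ge>0. (\<lambda>x. r * a x + s * b x) \<in> A"
    \<comment> \<open>assumption (ii)\<close>
    and KKsub: "\<forall>t\<le>T. \<forall>n\<ge>1. KK t n \<subseteq>
                  {y. (\<forall>j\<in>{1..d}. y j \<in> K t j) \<and> (\<forall>j. j \<notin> {1..d} \<longrightarrow> y j = 0)}"
    and KKcompact: "\<forall>t\<le>T. \<forall>n\<ge>1. compact (KK t n)"
    and fE: "\<forall>t\<le>T. \<forall>n\<ge>1. f t n \<in> E t"
    and fnonneg: "\<forall>t\<le>T. \<forall>n\<ge>1. \<forall>x\<in>Om. 0 \<le> f t n x"
    and fdom: "\<forall>n\<ge>1. \<forall>x\<in>Om. \<not> (\<forall>t\<le>T. (\<lambda>j. x (t,j)) \<in> KK t n) \<longrightarrow>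
                  1 + absum d T x \<le> (\<Sum>t\<le>T. f t n x)"
    and fV: "\<forall>\<Gamma>>0. (\<lambda>n. Vfun U (\<lambda>t. if t \<le> T then (\<lambda>x. \<Gamma> * f t n x) else (\<lambda>x. 0)))
                  \<longlonglongrightarrow> 0"
  shows
    "((\<exists>ch\<in>Bspace d T K. Pfrak T Om E U A (\<lambda>x. ereal (ch x)) < \<infinity>) \<longrightarrow>
        (\<forall>c\<in>Bspace d T K. Pfrak T Om E U A (\<lambda>x. ereal (c x)) \<noteq> \<infinity> \<and> Pfrak T Om E U A (\<lambda>x. ereal (c x)) \<noteq> -\<infinity>)
      \<and> (\<forall>c\<in>Bspace d T K. \<forall>\<epsilon>>0. \<exists>\<delta>>0. \<forall>c'\<in>Bspace d T K.
           normB d T K (\<lambda>x. c' x - c x) < ereal \<delta> \<longrightarrow>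
           \<bar>real_of_ereal (Pfrak T Om E U A (\<lambda>x. ereal (c' x)))
             - real_of_ereal (Pfrak T Om E U A (\<lambda>x. ereal (c x)))\<bar> < \<epsilon>)
      \<and> (\<forall>c\<in>Bspace d T K. \<forall>k::real.
           Pfrak T Om E U A (\<lambda>x. ereal (c x + k)) = Pfrak T Om E U A (\<lambda>x. ereal (c x)) + ereal k)
      \<and> (\<forall>c\<in>Bspace d T K. \<forall>c'\<in>Bspace d T K. \<forall>l\<in>{0..(1::real)}.
           ereal l * Pfrak T Om E U A (\<lambda>x. ereal (c x))
             + ereal (1 - l) * Pfrak T Om E U A (\<lambda>x. ereal (c' x))
           \<le> Pfrak T Om E U A (\<lambda>x. ereal (l * c x + (1 - l) * c' x)))
      \<and> (\<forall>c\<in>Bspace d T K. \<forall>c'\<in>Bspace d T K. (\<forall>x\<in>Om. c x \<le> c' x) \<longrightarrow>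
           Pfrak T Om E U A (\<lambda>x. ereal (c x)) \<le> Pfrak T Om E U A (\<lambda>x. ereal (c' x))))
     \<and> (\<forall>Q\<in>Prob1 d T K. Dcal T E U Q =
           (SUP \<phi>\<in>Ecal T E. ereal (\<Sum>t\<le>T. integral\<^sup>L Q (\<phi> t)) - Vfun U \<phi>))
     \<and> (\<forall>c::pt \<Rightarrow> ereal. \<forall>Acst::real.
          lsc_on Om c \<and> 0 \<le> Acst \<and> (\<forall>x\<in>Om. c x \<noteq> -\<infinity>) \<and>
          (\<forall>x\<in>Om. ereal (- Acst * (1 + absum d T x)) \<le> c x) \<longrightarrow>
            Pfrak T Om E U A c =
              (INF Q\<in>Prob1 d T K \<inter> polarP A. ExpQ Q c + Dcal T E U Q)
          \<and> (Pfrak T Om E U A c < \<infinity> \<longrightarrow>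
              (\<exists>Q\<in>Prob1 d T K \<inter> polarP A. Pfrak T Om E U A c = ExpQ Q c + Dcal T E U Q)))"
proof -
  interpret tight_subhedging d T K E U A KK f
    by (rule tight_subhedging.intro[OF subhedging.intro[OF Kclosed Esub Eadd Esmult
            Econst[unfolded Om_def] Ufin Uconc U0 Asub A0 Acone]
          tight_subhedging_axioms.intro[OF KKcompact fE fnonneg[unfolded Om_def]
            fdom[unfolded Om_def] fV]])
  show ?thesis
    unfolding Om_def
  proof (intro conjI impI ballI allI)
    fix c :: "pt \<Rightarrow> ereal" and Acst
    assume "lsc_on (Omega d T K) c \<and> 0 \<le> Acst \<and> (\<forall>x\<in>Omega d T K. c x \<noteq> -\<infinity>) \<and>
      (\<forall>x\<in>Omega d T K. ereal (- Acst * (1 + absum d T x)) \<le> c x)"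
    then have lsc_below: "lsc_on (Omega d T K) c"
      "weighted_bounded_below (Omega d T K) w c"
      by (auto simp: weighted_bounded_below_def path_weight_def)
    show "P c = (INF Q\<in>Prob1 d T K \<inter> polarP A. ExpQ Q c + Dcal T E U Q)"
      by (rule duality_INF[OF lsc_below])
    show "\<exists>Q\<in>Prob1 d T K \<inter> polarP A. P c = ExpQ Q c + Dcal T E U Q" if "P c < \<infinity>"
      by (rule duality_attained[OF lsc_below that])
  qed (rule P_ereal_finite P_norm_continuous P_cash_additive P_ereal_concave P_mono Dcal_eq_SUP_V;
      simp add: subsetD[OF Bspace_subset_weighted_bounded])+
qed

end
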